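(* Assume that $K^*(0)$ is non-empty. Then $K^*(\alpha)$ is non-empty for all $\alpha>0$. Moreover, the set-valued map $\alpha\mapsto K^*(\alpha)$, $\alpha\in[0,\infty)$, is upper hemi-continuous, and the optimal cost $\alpha\mapsto J(K^*(\alpha),\alpha)$ is continuous and strictly decreasing in $\alpha$.
   Context: Setting. Let $A\in\mathbb{R}^{n\times n}$, $B\in\mathbb{R}^{n\times m}$, $Q\in\mathbb{R}^{n\times n}$ symmetric positive semidefinite, $R\in\mathbb{R}^{m\times m}$ symmetric positive definite, and $D_0\in\mathbb{R}^{n\times n}$ symmetric positive definite. A real square matrix is stable if all its eigenvalues lie in the open left half plane. Let $\mathcal{S}\subseteq\mathbb{R}^{m\times n}$ be a linear subspace (often given by requiring certain entries to vanish). For a damping parameter $\alpha$ and $K\in\mathbb{R}^{m\times n}$ such that $A-\alpha I+BK$ is stable, define $$J(K,\alpha)=\mathbb{E}\int_0^\infty\left[x(t)^\top Qx(t)+u(t)^\top Ru(t)\right]dt,\quad \dot x(t)=(A-\alpha I)x(t)+Bu(t),\ u(t)=Kx(t),$$ where $x(0)=x_0$ is a random vector with zero mean and $\mathbb{E}[x_0x_0^\top]=D_0$. Equivalently, $J(K,\alpha)=\mathrm{tr}(D_0P)$ where $P$ is the unique solution of $(A-\alpha I+BK)^\top P+P(A-\alpha I+BK)+K^\top RK+Q=0$. $K^*(\alpha)$ denotes the set of globally optimal solutions (global minimizers) of the problem: minimize $J(K,\alpha)$ over $K\in\mathcal{S}$ such that $A-\alpha I+BK$ is stable. $J(K^*(\alpha),\alpha)$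 denotes the corresponding minimum value. A set-valued map $\Gamma:\mathcal{A}\to\mathcal{B}$ is upper hemi-continuous at $a$ if for any open neighborhood $V$ of $\Gamma(a)$ there is a neighborhood $U$ of $a$ such that $\Gamma(U)\subseteq V$; it is upper hemi-continuous if this holds at every $a\in\mathcal{A}$.
   Formalization: The formal theorem additionally assumes that (A,Q) is detectable and Q ≠ 0; the claim fails without them: for A=B=R=D_0=1, Q=0, S=ℝ, K*(0)={-2} but K*(1) is empty, and for A=-1, Q=0 the optimal cost is constantly 0. *)

theory Defs
  imports "HOL-Probability.Probability"
begin

definition pos_semidef :: "real^'n^'n \<Rightarrow> bool" where
  "pos_semidef M \<longleftrightarrow> transpose M = M \<and> (\<forall>x. 0 \<le> x \<bullet> (M *v x))"

definition pos_def :: "real^'n^'n \<Rightarrow> bool" where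
  "pos_def M \<longleftrightarrow> transpose M = M \<and> (\<forall>x. x \<noteq> 0 \<longrightarrow> 0 < x \<bullet> (M *v x))"

definition complex_eigenvalue :: "real^'n^'n \<Rightarrow> complex \<Rightarrow> bool" where
  "complex_eigenvalue M \<mu> \<longleftrightarrow> (\<exists>v. v \<noteq> 0 \<and> map_matrix complex_of_real M *v v = \<mu> *s v)"

definition stable :: "real^'n^'n \<Rightarrow> bool" where
  "stable M \<longleftrightarrow> (\<forall>\<mu>. complex_eigenvalue M \<mu> \<longrightarrow> Re \<mu> < 0)"

(* For positive semidefinite Q, detectability of (A, Q) and of (A, sqrt Q) coincide, since Q and
   its square root have the same kernel. *)
definition detectable :: "real^'n^'n \<Rightarrow> real^'n^'n \<Rightarrow> bool" where
  "detectable A Q \<longleftrightarrow> (\<exists>L. stable (A + L ** Q))"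

(* Here mat \<alpha> is \<alpha> times the identity matrix. *)
definition damped :: "real^'n^'n \<Rightarrow> real \<Rightarrow> real^'n^'n" where
  "damped A \<alpha> = A - mat \<alpha>"

definition closed_loop_solution ::
  "real^'n^'n \<Rightarrow> real^'m^'n \<Rightarrow> real^'n^'m \<Rightarrow> real^'n \<Rightarrow> (real \<Rightarrow> real^'n) \<Rightarrow> bool" where
  "closed_loop_solution A B K \<xi> x \<longleftrightarrow>
     x 0 = \<xi> \<and>
     (\<forall>t\<ge>0. (x has_vector_derivative (A *v x t + B *v (K *v x t))) (at t within {0..}))"

(* A solution exists and its values on {0..} are unique; only these values are used below. *)
definition closed_loop_trajectory ::
  "real^'n^'n \<Rightarrow> real^'m^'n \<Rightarrow> real^'n^'m \<Rightarrow> real^'n \<Rightarrow> real \<Rightarrow> real^'n" where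
  "closed_loop_trajectory A B K \<xi> = (SOME x. closed_loop_solution A B K \<xi> x)"

definition running_cost ::
  "real^'n^'n \<Rightarrow> real^'m^'m \<Rightarrow> real^'n^'m \<Rightarrow> real^'n \<Rightarrow> real" where
  "running_cost Q R K x = x \<bullet> (Q *v x) + (K *v x) \<bullet> (R *v (K *v x))"

(* The random initial state x0 lives on the probability space M. The cost is only used where
   damped A \<alpha> + B ** K is stable; there both integrals converge, so the convention that
   divergent integrals are 0 plays no role. *)
definition lqr_cost ::
  "'w measure \<Rightarrow> ('w \<Rightarrow> real^'n) \<Rightarrow> real^'n^'n \<Rightarrow> real^'m^'n \<Rightarrow> real^'n^'n \<Rightarrow> real^'m^'m
     \<Rightarrow> real^'n^'m \<Rightarrow> real \<Rightarrow> real" where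
  "lqr_cost M x0 A B Q R K \<alpha> =
     (LINT \<omega>|M. (LINT t:{0..}|lborel.
        running_cost Q R K (closed_loop_trajectory (damped A \<alpha>) B K (x0 \<omega>) t)))"

definition feasible_gains ::
  "real^'n^'n \<Rightarrow> real^'m^'n \<Rightarrow> (real^'n^'m) set \<Rightarrow> real \<Rightarrow> (real^'n^'m) set" where
  "feasible_gains A B S \<alpha> = {K \<in> S. stable (damped A \<alpha> + B ** K)}"

definition optimal_gains ::
  "'w measure \<Rightarrow> ('w \<Rightarrow> real^'n) \<Rightarrow> real^'n^'n \<Rightarrow> real^'m^'n \<Rightarrow> real^'n^'n \<Rightarrow> real^'m^'m
     \<Rightarrow> (real^'n^'m) set \<Rightarrow> real \<Rightarrow> (real^'n^'m) set" where
  "optimal_gains M x0 A B Q R S \<alpha> =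
     {K \<in> feasible_gains A B S \<alpha>.
        \<forall>K' \<in> feasible_gains A B S \<alpha>. lqr_cost M x0 A B Q R K \<alpha> \<le> lqr_cost M x0 A B Q R K' \<alpha>}"

(* All optimal gains have the same cost, so the image is a singleton whenever an optimal gain
   exists. *)
definition optimal_cost ::
  "'w measure \<Rightarrow> ('w \<Rightarrow> real^'n) \<Rightarrow> real^'n^'n \<Rightarrow> real^'m^'n \<Rightarrow> real^'n^'n \<Rightarrow> real^'m^'m
     \<Rightarrow> (real^'n^'m) set \<Rightarrow> real \<Rightarrow> real" where
  "optimal_cost M x0 A B Q R S \<alpha> =
     the_elem ((\<lambda>K. lqr_cost M x0 A B Q R K \<alpha>) ` optimal_gains M x0 A B Q R S \<alpha>)"

definition upper_hemicontinuous_on ::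
  "'a::topological_space set \<Rightarrow> ('a \<Rightarrow> 'b::topological_space set) \<Rightarrow> bool" where
  "upper_hemicontinuous_on X \<Gamma> \<longleftrightarrow>
     (\<forall>a\<in>X. \<forall>V. open V \<and> \<Gamma> a \<subseteq> V \<longrightarrow>
        (\<exists>U. open U \<and> a \<in> U \<and> (\<Union>x\<in>U \<inter> X. \<Gamma> x) \<subseteq> V))"

end

theory Submission
  imports Defs "HOL-Computational_Algebra.Fundamental_Theorem_Algebra"
begin

text \<open>
  On feasible gains the cost is the inner product of \<open>D0\<close> with the solution \<open>P\<close> of the Lyapunov
  equation. Conversely, by detectability, any positive semidefinite \<open>P\<close> satisfying the Lyapunov
  inequality for some \<open>K\<close> forces \<open>K\<close> to be feasible, with cost at most that inner product.
  Since \<open>D0\<close> is positive definite, a bound on the cost bounds \<open>P\<close>, and then the Lyapunov equation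
  bounds \<open>K\<close>, as it is quadratic in \<open>K\<close> with positive definite leading term and otherwise linear.
  Hence the pairs \<open>(K, \<alpha>)\<close> with \<open>\<alpha>\<close> in a compact interval and bounded cost form a compact set on
  which the cost is continuous. Together with upper semicontinuity of the cost in \<open>\<alpha>\<close> for
  fixed \<open>K\<close>, this yields existence of minimizers, hemicontinuity and continuity; strict monotonicity
  comes from comparing the Lyapunov solutions at two dampings.
\<close>

section \<open>Stable linear systems\<close>

text \<open>Once \<open>h < a * e / 2\<close>, the integrating factor \<open>exp (a * t)\<close>
  turns the excess \<open>f - e / 2\<close> into a nonincreasing function. The excess is then
  bounded by a multiple of \<open>exp (- (a * t))\<close>, so \<open>f\<close> eventually stays
  below \<open>e\<close>.\<close>

lemma comparison_decay:
  fixes f f' h :: "real \<Rightarrow> real"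
  assumes a: "a > 0" and f': "\<And>t. (f has_real_derivative f' t) (at t)"
    and le: "\<And>t. f' t \<le> - a * f t + h t"
    and h: "(h \<longlongrightarrow> 0) at_top" and nn: "\<And>t. 0 \<le> f t"
  shows "(f \<longlongrightarrow> 0) at_top"
proof (rule tendstoI)
  fix e :: real assume e: "e > 0"
  have "eventually (\<lambda>t. h t < a * e / 2) at_top"
    by (rule order_tendstoD(2)[OF h]) (use a e in simp)
  then obtain T where T: "\<And>t. t \<ge> T \<Longrightarrow> h t < a * e / 2"
    by (auto simp: eventually_at_top_linorder)
  define g where "g t = (f t - e / 2) * exp (a * t)" for t
  have dg: "(g has_real_derivative (f' t + a * (f t - e / 2)) * exp (a * t)) (at t)" for t
    unfolding g_def by (auto intro!: derivative_eq_intros f' simp: algebra_simps)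
  have g_le: "g t \<le> g T" if "t \<ge> T" for t
  proof (rule DERIV_nonpos_imp_nonincreasing[OF that])
    fix s assume "T \<le> s" "s \<le> t"
    then have "(f' s + a * (f s - e / 2)) * exp (a * s) \<le> 0"
      using le[of s] T[of s] by (intro mult_nonpos_nonneg) (auto simp: algebra_simps)
    then show "\<exists>y. (g has_real_derivative y) (at s) \<and> y \<le> 0" using dg by blast
  qed
  have "((\<lambda>t. g T * exp (- (a * t))) \<longlongrightarrow> g T * 0) at_top"
    using a by (intro tendsto_mult tendsto_const filterlim_compose[OF exp_at_bot]
        filterlim_compose[OF filterlim_uminus_at_bot_at_top]
        filterlim_tendsto_pos_mult_at_top[OF tendsto_const] filterlim_ident)
  then have "eventually (\<lambda>t. g T * exp (- (a * t)) < e / 2) at_top"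
    by (rule order_tendstoD(2)) (use e in simp)
  then show "eventually (\<lambda>t. dist (f t) 0 < e) at_top"
    using eventually_ge_at_top[of T]
  proof eventually_elim
    case (elim t)
    have "f t - e / 2 = g t * exp (- (a * t))" by (simp add: g_def exp_minus)
    also have "\<dots> \<le> g T * exp (- (a * t))" using g_le[OF elim(2)] by (simp add: mult_right_mono)
    finally show ?case using elim nn[of t] by simp
  qed
qed

section \<open>Polynomials in a matrix\<close>

text \<open>Horner evaluation of \<open>p(M) v\<close>. Acting on a vector directly avoids matrix
  powers.\<close>

definition poly_apply :: "'a::field^'n^'n \<Rightarrow> 'a poly \<Rightarrow> 'a^'n \<Rightarrow> 'a^'n" where
  "poly_apply M p v = fold_coeffs (\<lambda>a w. a *s v + M *v w) p 0"

lemma poly_apply_0 [simp]: "poly_apply M 0 v = 0"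
  by (simp add: poly_apply_def)

lemma poly_apply_pCons [simp]: "poly_apply M (pCons a p) v = a *s v + M *v poly_apply M p v"
  by (cases "p = 0 \<and> a = 0") (auto simp: poly_apply_def)

lemma poly_apply_add: "poly_apply M (p + q) v = poly_apply M p v + poly_apply M q v"
  by (induction p q rule: poly_induct2)
    (auto simp: vector_sadd_rdistrib matrix_vector_right_distrib)

lemma poly_apply_smult: "poly_apply M (smult c p) v = c *s poly_apply M p v"
  by (induction p) (auto simp: vector_ssub_ldistrib vector_add_ldistrib vector_smult_assoc
      matrix_vector_mult_scaleR vector_scalar_commute)

lemma poly_apply_diff: "poly_apply M (p - q) v = poly_apply M p v - poly_apply M q v"
proof -
  have "poly_apply M (p - q) v = poly_apply M (p + smult (-1) q) v" by simp
  also have "\<dots> = poly_apply M p v - poly_apply M q v"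
    by (simp only: poly_apply_add poly_apply_smult) (simp add: vec_eq_iff)
  finally show ?thesis .
qed

lemma poly_apply_linear_factor:
  "poly_apply M ([:- \<mu>, 1:] * q) v = M *v poly_apply M q v - \<mu> *s poly_apply M q v"
  by (simp add: poly_apply_diff poly_apply_smult)

lemma poly_apply_commute:
  "poly_apply M p (M *v v - \<mu> *s v) = M *v poly_apply M p v - \<mu> *s poly_apply M p v"
proof (induction p)
  case (pCons a p)
  have "poly_apply M (pCons a p) (M *v v - \<mu> *s v)
      = a *s (M *v v - \<mu> *s v) + M *v (M *v poly_apply M p v - \<mu> *s poly_apply M p v)"
    by (simp only: poly_apply_pCons pCons.IH)
  also have "\<dots> = M *v (a *s v + M *v poly_apply M p v) - \<mu> *s (a *s v + M *v poly_apply M p v)"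
    by (simp only: matrix_vector_mult_diff_distrib matrix_vector_right_distrib vector_scalar_commute)
      (simp add: vec_eq_iff algebra_simps)
  finally show ?case by (simp only: poly_apply_pCons)
qed simp

text \<open>Otherwise every initial segment would consist of distinct independent vectors, more of
  them than the dimension allows. The cardinality is carried along because the dimension bound
  counts the image set.\<close>

lemma ex_in_span_previous:
  fixes u :: "nat \<Rightarrow> 'a::euclidean_space"
  shows "\<exists>k. u k \<in> span (u ` {..<k})"
proof (rule ccontr)
  assume H: "\<nexists>k. u k \<in> span (u ` {..<k})"
  have ind: "independent (u ` {..<k}) \<and> card (u ` {..<k}) = k" for k
  proof (induction k)
    case (Suc k)
    have 1: "u k \<notin> span (u ` {..<k})" using H by blast
    then have 2: "u k \<notin> u ` {..<k}" by (metis span_base)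
    have "u ` {..<Suc k} = insert (u k) (u ` {..<k})" by (simp add: lessThan_Suc)
    moreover have "independent (insert (u k) (u ` {..<k}))"
      using Suc 1 by (metis independent_insertI)
    moreover have "card (insert (u k) (u ` {..<k})) = Suc k"
      using Suc 2 by (metis card_insert_disjoint finite_imageI finite_lessThan)
    ultimately show ?case by metis
  next
    case 0
    have "u ` {..<0} = {}" by simp
    then show ?case by (metis independent_empty card.empty)
  qed
  have "Suc (DIM('a)) \<le> DIM('a)"
    using ind[of "Suc (DIM('a))"] independent_bound by metis
  then show False by simp
qed

text \<open>The powers \<open>u k\<close> of \<open>M\<close> live in a finite-dimensional space, so
  some power is a combination of earlier ones.\<close>

lemma ex_annihilating_poly:
  fixes M :: "complex^'n^'n"
  shows "\<exists>p. p \<noteq> 0 \<and> (\<forall>v. poly_apply M p v = 0)"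
proof -
  define u where "u k = ((\<lambda>X. M ** X) ^^ k) (mat 1)" for k
  obtain k where k: "u k \<in> span (u ` {..<k})" using ex_in_span_previous by blast
  have mono: "poly_apply M (monom 1 j) v = u j *v v" for j v
    by (induction j) (auto simp: u_def monom_0 monom_Suc matrix_vector_mul_assoc)
  \<comment> \<open>The condition on coefficients keeps the leading term of
    \<open>monom 1 k - p\<close> from cancelling below. The span is over the reals, hence the
    \<open>of_real\<close> in the witness.\<close>
  have "\<exists>p. (\<forall>i\<ge>k. coeff p i = 0) \<and> (\<forall>v. poly_apply M p v = X *v v)"
    if "X \<in> span (u ` {..<k})" for X
    using that
  proof (induction rule: span_induct_alt)
    case base
    then show ?case by (intro exI[of _ 0]) auto
  next
    case (step c x y)
    then obtain j p where j: "j < k" "x = u j" and p: "\<forall>i\<ge>k. coeff p i = 0"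
      "\<forall>v. poly_apply M p v = y *v v" by auto
    have "(c *\<^sub>R x + y) *v v = of_real c *s (x *v v) + y *v v" for v
      by (simp add: vec_eq_iff matrix_vector_mult_def sum_distrib_left algebra_simps
          sum.distrib scaleR_conv_of_real[where 'a = complex])
    with j p show ?case
      by (intro exI[of _ "smult (of_real c) (monom 1 j) + p"])
        (auto simp: poly_apply_add poly_apply_smult mono)
  qed
  from this[OF k] obtain p where p: "\<forall>i\<ge>k. coeff p i = 0" "\<forall>v. poly_apply M p v = u k *v v"
    by blast
  have "coeff (monom 1 k - p) k = 1" using p by simp
  then have "monom 1 k - p \<noteq> 0" by (metis coeff_0 zero_neq_one)
  with p show ?thesis by (intro exI[of _ "monom 1 k - p"]) (auto simp: poly_apply_diff mono)
qed

section \<open>Decay of solutions of stable systems\<close>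

text \<open>Energy estimate: the squared norm of \<open>z\<close> satisfies the hypothesis of
  \<open>comparison_decay\<close> with a forcing term of order
  \<open>(norm (y t))\<^sup>2\<close>.\<close>

lemma forced_decay:
  fixes z y :: "real \<Rightarrow> complex^'n"
  assumes \<mu>: "Re \<mu> < 0" and z: "\<And>t. (z has_vector_derivative (\<mu> *s z t + y t)) (at t)"
    and y: "(y \<longlongrightarrow> 0) at_top"
  shows "(z \<longlongrightarrow> 0) at_top"
proof -
  define a where "a = - Re \<mu>"
  have a: "a > 0" using \<mu> by (simp add: a_def)
  \<comment> \<open>The inner product on \<open>complex^'n\<close> is the real part of the Hermitian
    one, so \<open>Im \<mu>\<close> drops out.\<close>
  have ins: "w \<bullet> (\<mu> *s w) = - a * (w \<bullet> w)" for w :: "complex^'n"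
    by (simp add: inner_vec_def a_def inner_complex_def sum_distrib_left sum_negf[symmetric])
      (simp add: algebra_simps)
  have "((\<lambda>t. z t \<bullet> z t) \<longlongrightarrow> 0) at_top"
  proof (rule comparison_decay[OF a, where f' = "\<lambda>t. 2 * (z t \<bullet> (\<mu> *s z t + y t))"
        and h = "\<lambda>t. (norm (y t))\<^sup>2 / a"])
    fix t
    have "((\<lambda>t. z t \<bullet> z t) has_vector_derivative (z t \<bullet> (\<mu> *s z t + y t) + (\<mu> *s z t + y t) \<bullet> z t)) (at t)"
      by (rule bounded_bilinear.has_vector_derivative[OF bounded_bilinear_inner z z])
    then show "((\<lambda>t. z t \<bullet> z t) has_real_derivative 2 * (z t \<bullet> (\<mu> *s z t + y t))) (at t)"
      by (simp add: has_real_derivative_iff_has_vector_derivative inner_commute)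
    have "2 * (z t \<bullet> y t) \<le> 2 * (norm (z t) * norm (y t))"
      using norm_cauchy_schwarz by simp
    \<comment> \<open>Young's inequality, weighted so that only half of the dissipation
      \<open>2 * a\<close> is spent on the mixed term.\<close>
    also have "\<dots> \<le> a * (norm (z t))\<^sup>2 + (norm (y t))\<^sup>2 / a"
    proof -
      have "0 \<le> (a * norm (z t) - norm (y t))\<^sup>2 / a" using a by simp
      also have "\<dots> = a * (norm (z t))\<^sup>2 + (norm (y t))\<^sup>2 / a - 2 * (norm (z t) * norm (y t))"
        using a by (simp add: field_simps power2_eq_square)
      finally show ?thesis by simp
    qed
    finally show "2 * (z t \<bullet> (\<mu> *s z t + y t)) \<le> - a * (z t \<bullet> z t) + (norm (y t))\<^sup>2 / a"
      by (simp add: inner_add_right ins power2_norm_eq_inner)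
  next
    show "((\<lambda>t. (norm (y t))\<^sup>2 / a) \<longlongrightarrow> 0) at_top"
      using a by (auto intro!: tendsto_eq_intros y)
  qed auto
  then have "((\<lambda>t. sqrt (z t \<bullet> z t)) \<longlongrightarrow> sqrt 0) at_top" by (rule tendsto_real_sqrt)
  then show ?thesis by (simp add: norm_eq_sqrt_inner[symmetric] tendsto_norm_zero_iff)
qed

text \<open>
  Induction on the degree of an annihilating polynomial: a root \<open>\<mu>\<close> that is not an eigenvalue can be
  cancelled; for an eigenvalue, \<open>z\<close> solves \<open>z' = \<mu> z + y\<close>, where \<open>y = (M - \<mu>) z\<close> is annihilated by the
  quotient and hence decays.
\<close>
lemma complex_solution_decays:
  fixes M :: "complex^'n^'n"
  assumes M: "\<And>\<mu> v. v \<noteq> 0 \<Longrightarrow> M *v v = \<mu> *s v \<Longrightarrow> Re \<mu> < 0"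
    and "p \<noteq> 0" and "\<And>t. (z has_vector_derivative M *v z t) (at t)" and "\<And>t. poly_apply M p (z t) = 0"
  shows "(z \<longlongrightarrow> 0) at_top"
  using assms(2-)
proof (induction "degree p" arbitrary: p z)
  case 0
  then obtain c where "p = [:c:]" "c \<noteq> 0" by (metis degree_eq_zeroE pCons_0_0)
  with 0 have "z t = 0" for t by (simp add: vec_eq_iff) 
  then show ?case by (simp add: fun_eq_iff)
next
  case (Suc d)
  then have "\<not> constant (poly p)" by (simp add: constant_degree)
  then obtain \<mu> where "poly p \<mu> = 0" using fundamental_theorem_of_algebra by blast
  then obtain q where q: "p = [:- \<mu>, 1:] * q" unfolding poly_eq_0_iff_dvd by (rule dvdE)
  with Suc have q0: "q \<noteq> 0" by auto
  then have dq: "d = degree q" using Suc(2) by (simp add: q degree_mult_eq del: mult_pCons_left)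
  have ker: "M *v poly_apply M q (z t) = \<mu> *s poly_apply M q (z t)" for t
    using Suc.prems(3)[of t] unfolding q poly_apply_linear_factor by simp
  show ?case
  proof (cases "\<exists>v. v \<noteq> 0 \<and> M *v v = \<mu> *s v")
    case True
    then have mu: "Re \<mu> < 0" using M by blast
    let ?y = "\<lambda>t. M *v z t - \<mu> *s z t"
    have lin: "bounded_linear (\<lambda>v. M *v v - \<mu> *s v)"
      by (auto intro!: linearI simp: linear_conv_bounded_linear[symmetric] vec_eq_iff matrix_vector_mult_def
          algebra_simps sum.distrib scaleR_conv_of_real[where 'a = complex] sum_distrib_left)
    have "(?y \<longlongrightarrow> 0) at_top"
    proof (rule Suc.hyps(1)[OF dq q0])
      fix t
      show "(?y has_vector_derivative M *v ?y t) (at t)"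
        using bounded_linear.has_vector_derivative[OF lin Suc.prems(2)[of t]]
        by (simp add: matrix_vector_mult_diff_distrib vector_scalar_commute)
      show "poly_apply M q (?y t) = 0" by (simp add: poly_apply_commute ker)
    qed
    then show ?thesis
      by (rule forced_decay[OF mu, rotated]) (use Suc.prems(2) in simp)
  next
    case False
    then have "poly_apply M q (z t) = 0" for t using ker by blast
    then show ?thesis by (intro Suc.hyps(1)[OF dq q0]) (use Suc in auto)
  qed
qed

text \<open>Eigenvectors may be complex, so the trajectory is embedded by \<open>c\<close> into
  \<open>complex^'n\<close>, where it decays; real parts of the components give it back.\<close>

lemma stable_decay:
  fixes M :: "real^'n^'n"
  assumes M: "stable M" and x: "\<And>t. (x has_vector_derivative M *v x t) (at t)"
  shows "(x \<longlongrightarrow> 0) at_top"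
proof -
  define c :: "real^'n \<Rightarrow> complex^'n" where "c v = (\<chi> i. of_real (v $ i))" for v
  let ?Mc = "map_matrix complex_of_real M"
  have lin: "bounded_linear c"
    by (auto intro!: linearI simp: linear_conv_bounded_linear[symmetric] c_def vec_eq_iff
        scaleR_conv_of_real[where 'a = complex])
  have cM: "c (M *v v) = ?Mc *v c v" for v
    by (simp add: c_def vec_eq_iff matrix_vector_mult_def map_matrix_def)
  obtain p where p: "p \<noteq> 0" "\<forall>v. poly_apply ?Mc p v = 0" using ex_annihilating_poly by blast
  have "((\<lambda>t. c (x t)) \<longlongrightarrow> 0) at_top"
  proof (rule complex_solution_decays[OF _ p(1)])
    show "Re \<mu> < 0" if "v \<noteq> 0" "?Mc *v v = \<mu> *s v" for \<mu> v
      using that M by (auto simp: stable_def complex_eigenvalue_def)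
    show "((\<lambda>t. c (x t)) has_vector_derivative ?Mc *v c (x t)) (at t)" for t
      using bounded_linear.has_vector_derivative[OF lin x[of t]] by (simp add: cM)
  qed (use p in auto)
  then have "((\<lambda>t. c (x t) $ i) \<longlongrightarrow> 0 $ i) at_top" for i by (rule tendsto_vec_nth)
  then have "((\<lambda>t. Re (c (x t) $ i)) \<longlongrightarrow> Re (0 $ i)) at_top" for i by (rule tendsto_Re)
  then show ?thesis by (intro vec_tendstoI) (simp add: c_def)
qed

section \<open>The matrix exponential and uniqueness of trajectories\<close>

text \<open>This is \<open>exp(t M) \<xi>\<close>, written as one scalar power series per component
  so that termwise differentiation of real series applies.\<close>

definition flow :: "real^'n^'n \<Rightarrow> real^'n \<Rightarrow> real \<Rightarrow> real^'n" where
  "flow M \<xi> t = (\<chi> i. \<Sum>k. (((*v) M ^^ k) \<xi> $ i / fact k) * t ^ k)"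

lemma flow_summable:
  fixes M :: "real^'n^'n"
  shows "summable (\<lambda>k. (((*v) M ^^ k) \<xi> $ i / fact k) * t ^ k)"
proof -
  let ?c = "onorm ((*v) M)"
  have "norm (((*v) M ^^ k) \<xi>) \<le> ?c ^ k * norm \<xi>" for k
  proof (induction k)
    case (Suc k)
    have "norm (((*v) M ^^ Suc k) \<xi>) \<le> ?c * norm (((*v) M ^^ k) \<xi>)"
      using onorm[OF matrix_vector_mul_bounded_linear, of M "((*v) M ^^ k) \<xi>"] by simp
    also have "\<dots> \<le> ?c * (?c ^ k * norm \<xi>)"
      by (rule mult_left_mono[OF Suc]) (simp add: onorm_pos_le)
    finally show ?case by (simp add: mult.assoc)
  qed simp
  then have b: "\<bar>((*v) M ^^ k) \<xi> $ i\<bar> \<le> ?c ^ k * norm \<xi>" for k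
    using component_le_norm_cart order_trans by blast
  have "norm ((((*v) M ^^ k) \<xi> $ i / fact k) * t ^ k) \<le> norm \<xi> * (inverse (fact k) * (?c * \<bar>t\<bar>) ^ k)" for k
  proof -
    have "norm ((((*v) M ^^ k) \<xi> $ i / fact k) * t ^ k)
        = \<bar>((*v) M ^^ k) \<xi> $ i\<bar> * (\<bar>t\<bar> ^ k / fact k)"
      by (simp add: abs_mult power_abs)
    also have "\<dots> \<le> (?c ^ k * norm \<xi>) * (\<bar>t\<bar> ^ k / fact k)"
      by (rule mult_right_mono[OF b]) simp
    finally show ?thesis by (simp add: power_mult_distrib field_simps)
  qed
  then show ?thesis
    by (intro summable_comparison_test'[OF summable_mult[OF summable_exp]]) blast
qed

lemma flow_0: "flow M \<xi> 0 = \<xi>"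
proof -
  have "(\<Sum>k. c k * (0::real) ^ k) = c 0" for c :: "nat \<Rightarrow> real" using powser_sums_zero sums_unique by metis
  from this[of "\<lambda>k. ((*v) M ^^ k) \<xi> $ i / fact k" for i] show ?thesis
    by (simp add: flow_def vec_eq_iff)
qed

lemma flow_has_vector_derivative: "(flow M \<xi> has_vector_derivative M *v flow M \<xi> t) (at t)"
proof -
  let ?u = "\<lambda>k. ((*v) M ^^ k) \<xi>"
  define f where "f i t = (\<Sum>k. (?u k $ i / fact k) * t ^ k)" for i and t :: real
  define f' where "f' i t = (\<Sum>k. (?u (Suc k) $ i / fact k) * t ^ k)" for i and t :: real
  have df: "(f i has_real_derivative f' i t) (at t)" for i
  proof -
    \<comment> \<open>Termwise differentiation cancels \<open>Suc k\<close> against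
      \<open>fact (Suc k)\<close> and shifts the iterates by one, which amounts to applying
      \<open>M\<close>.\<close>
    have eq: "diffs (\<lambda>k. ?u k $ i / fact k) = (\<lambda>k. ?u (Suc k) $ i / fact k)"
    proof
      fix k
      have "diffs (\<lambda>k. ?u k $ i / fact k) k = real (Suc k) * (?u (Suc k) $ i / (real (Suc k) * fact k))"
        by (simp only: diffs_def fact_Suc)
      also have "\<dots> = ?u (Suc k) $ i / fact k"
        by (simp only: times_divide_eq_right nonzero_mult_divide_mult_cancel_left of_nat_eq_0_iff Suc_not_Zero not_False_eq_True)
      finally show "diffs (\<lambda>k. ?u k $ i / fact k) k = ?u (Suc k) $ i / fact k" .
    qed
    show ?thesis
      using termdiffs_strong_converges_everywhere[OF flow_summable[of M \<xi> i], of t]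
      unfolding eq f_def f'_def .
  qed
  have mf: "M *v flow M \<xi> t = (\<chi> i. f' i t)"
  proof (subst vec_eq_iff, rule allI)
    fix i
    have "(M *v flow M \<xi> t) $ i = (\<Sum>j\<in>UNIV. \<Sum>k. M $ i $ j * ((?u k $ j / fact k) * t ^ k))"
      by (simp add: matrix_vector_mult_def flow_def suminf_mult[OF flow_summable] del: times_divide_eq_left times_divide_eq_right)
    also have "\<dots> = (\<Sum>k. \<Sum>j\<in>UNIV. M $ i $ j * ((?u k $ j / fact k) * t ^ k))"
      by (intro suminf_sum[symmetric] summable_mult flow_summable)
    also have "\<dots> = f' i t"
      unfolding f'_def
      by (simp add: matrix_vector_mult_def sum_divide_distrib sum_distrib_right sum_distrib_left
          algebra_simps del: sum_divide_distrib[symmetric])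
    finally show "(M *v flow M \<xi> t) $ i = (\<chi> i. f' i t) $ i" by simp
  qed
  \<comment> \<open>Expansion in the standard basis lets the scalar derivatives be assembled by the
    sum rule.\<close>
  have exp: "(\<chi> i. g i) = (\<Sum>i\<in>UNIV. g i *\<^sub>R axis i 1)" for g :: "'a \<Rightarrow> real"
    using basis_expansion[of "\<chi> i. g i"] by (simp add: scalar_mult_eq_scaleR)
  have flow: "flow M \<xi> = (\<lambda>t. \<Sum>i\<in>UNIV. f i t *\<^sub>R axis i 1)"
    by (rule ext) (simp only: flow_def f_def exp)
  have "((\<lambda>t. f i t *\<^sub>R axis i 1) has_vector_derivative f' i t *\<^sub>R (axis i 1 :: real^'a)) (at t)" for i
    using has_vector_derivative_scaleR[OF df has_vector_derivative_const] by simp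
  then show ?thesis
    unfolding mf exp unfolding flow by (intro has_vector_derivative_sum)
qed

text \<open>Gronwall argument: the squared norm of the difference grows at rate at most
  \<open>2 * ?c\<close>, so \<open>g\<close> is nonincreasing, and it starts at \<open>0\<close>. At
  time \<open>0\<close> the derivative is only one-sided; there continuity of \<open>g\<close>
  suffices.\<close>

lemma solution_unique:
  fixes x y :: "real \<Rightarrow> real^'n"
  assumes x: "\<And>t. t \<ge> 0 \<Longrightarrow> (x has_vector_derivative M *v x t) (at t within {0..})"
    and y: "\<And>t. t \<ge> 0 \<Longrightarrow> (y has_vector_derivative M *v y t) (at t within {0..})"
    and 0: "x 0 = y 0" and t: "t \<ge> 0"
  shows "x t = y t"
proof -
  let ?c = "onorm ((*v) M)"
  define z where "z t = x t - y t" for t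
  have z: "(z has_vector_derivative M *v z t) (at t within {0..})" if "t \<ge> 0" for t
    unfolding z_def matrix_vector_mult_diff_distrib
    by (intro has_vector_derivative_diff x y that)
  define g where "g t = (z t \<bullet> z t) * exp (- (2 * ?c * t))" for t
  have dz: "((\<lambda>t. z t \<bullet> z t) has_real_derivative 2 * (z t \<bullet> (M *v z t))) (at t within {0..})" if "t \<ge> 0" for t
    using bounded_bilinear.has_vector_derivative[OF bounded_bilinear_inner z z, OF that that]
    by (simp add: has_real_derivative_iff_has_vector_derivative inner_commute)
  have dg: "(g has_real_derivative (2 * (z t \<bullet> (M *v z t)) - 2 * ?c * (z t \<bullet> z t)) * exp (- (2 * ?c * t)))
      (at t within {0..})" if "t \<ge> 0" for t
    unfolding g_def by (auto intro!: derivative_eq_intros dz[OF that] simp: algebra_simps)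
  have "g t \<le> g 0"
  proof (rule DERIV_nonpos_imp_decreasing_open[OF t])
    fix s assume s: "0 < s" "s < t"
    have "z s \<bullet> (M *v z s) \<le> norm (z s) * norm (M *v z s)" by (rule norm_cauchy_schwarz)
    also have "\<dots> \<le> norm (z s) * (?c * norm (z s))" by (intro mult_left_mono onorm) auto
    also have "\<dots> = ?c * (z s \<bullet> z s)"
      by (simp add: power2_norm_eq_inner[symmetric] power2_eq_square)
    finally have "(2 * (z s \<bullet> (M *v z s)) - 2 * ?c * (z s \<bullet> z s)) * exp (- (2 * ?c * s)) \<le> 0"
      by (intro mult_nonpos_nonneg) auto
    moreover have "at s within {0..} = at s" by (rule at_within_interior) (use s in \<open>simp add: interior_real_atLeast\<close>)
    ultimately show "\<exists>y. DERIV g s :> y \<and> y \<le> 0"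
      using dg[of s] less_imp_le[OF s(1)] by metis
  next
    have "continuous_on {0..} g"
      using dg by (auto intro!: DERIV_continuous_on)
    then show "continuous_on {0..t} g" by (rule continuous_on_subset) auto
  qed
  also have "g 0 = 0" using 0 by (simp add: g_def z_def)
  finally have "z t \<bullet> z t \<le> 0" by (simp add: g_def mult_le_0_iff)
  then show ?thesis by (metis antisym inner_ge_zero inner_eq_zero_iff z_def right_minus_eq)
qed

text \<open>\<open>flow\<close> shows that the choice in \<open>closed_loop_trajectory\<close> is
  made among actual solutions, and uniqueness fixes its values for nonnegative times.\<close>

lemma closed_loop_trajectory_eq:
  assumes "t \<ge> 0"
  shows "closed_loop_trajectory A B K \<xi> t = flow (A + B ** K) \<xi> t"
proof -
  let ?M = "A + B ** K"
  have M: "A *v v + B *v (K *v v) = ?M *v v" for v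
    by (simp add: matrix_vector_mult_add_rdistrib matrix_vector_mul_assoc)
  have "closed_loop_solution A B K \<xi> (flow ?M \<xi>)"
    unfolding closed_loop_solution_def M
    by (auto intro: has_vector_derivative_at_within[OF flow_has_vector_derivative] simp: flow_0)
  then have sol: "closed_loop_solution A B K \<xi> (closed_loop_trajectory A B K \<xi>)"
    unfolding closed_loop_trajectory_def by (rule someI[of "closed_loop_solution A B K \<xi>"])
  show ?thesis
  proof (rule solution_unique[OF _ _ _ assms])
    show "(closed_loop_trajectory A B K \<xi> has_vector_derivative ?M *v closed_loop_trajectory A B K \<xi> t)
        (at t within {0..})" if "t \<ge> 0" for t
      using sol that unfolding closed_loop_solution_def M by blast
    show "closed_loop_trajectory A B K \<xi> 0 = flow ?M \<xi> 0"
      using sol unfolding closed_loop_solution_def by (simp add: flow_0)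
    show "(flow ?M \<xi> has_vector_derivative ?M *v flow ?M \<xi> t) (at t within {0..})" for t
      by (rule has_vector_derivative_at_within[OF flow_has_vector_derivative])
  qed
qed

section \<open>Quadratic forms along trajectories and the Lyapunov equation\<close>

lemma inner_transpose_left: "(transpose M *v x) \<bullet> y = x \<bullet> ((M::real^'n^'m) *v y)"
  by (simp add: dot_lmul_matrix)

lemma inner_symmetric: "transpose P = P \<Longrightarrow> x \<bullet> (P *v y) = (P *v x) \<bullet> (y :: real^'n)"
  by (metis inner_transpose_left)

lemma bilinear_form_deriv:
  fixes P :: "real^'n^'n"
  assumes "(x has_vector_derivative x') (at t)" and "(y has_vector_derivative y') (at t)"
  shows "((\<lambda>t. x t \<bullet> (P *v y t)) has_real_derivative x t \<bullet> (P *v y') + x' \<bullet> (P *v y t)) (at t)"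
proof -
  have "((\<lambda>t. P *v y t) has_vector_derivative P *v y') (at t)"
    by (rule bounded_linear.has_vector_derivative[OF _ assms(2)]) simp
  from bounded_bilinear.has_vector_derivative[OF bounded_bilinear_inner assms(1) this]
  show ?thesis by (simp add: has_real_derivative_iff_has_vector_derivative)
qed

lemma flow_decay: "stable M \<Longrightarrow> (flow M \<xi> \<longlongrightarrow> 0) at_top"
  using stable_decay flow_has_vector_derivative by blast

lemma bilinear_form_decay:
  fixes P :: "real^'n^'n"
  assumes "stable M"
  shows "((\<lambda>t. flow M \<xi> t \<bullet> (P *v flow M \<eta> t)) \<longlongrightarrow> 0) at_top"
proof -
  have "((\<lambda>t. flow M \<xi> t \<bullet> (P *v flow M \<eta> t)) \<longlongrightarrow> 0 \<bullet> (P *v 0)) at_top"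
    by (intro tendsto_inner bounded_linear.tendsto[of "(*v) P"] flow_decay assms) simp
  then show ?thesis by simp
qed

text \<open>The form of \<open>N\<close> is nonincreasing along a trajectory and tends to
  \<open>0\<close>, so its initial value cannot be negative. Applied to differences of Lyapunov
  solutions, this becomes a comparison principle.\<close>

lemma lyapunov_nonneg:
  fixes N :: "real^'n^'n"
  assumes M: "stable M" and N: "transpose N = N" and le: "\<And>x. (M *v x) \<bullet> (N *v x) \<le> 0"
  shows "0 \<le> x \<bullet> (N *v x)"
proof -
  let ?f = "\<lambda>t. flow M x t \<bullet> (N *v flow M x t)"
  have d: "(?f has_real_derivative 2 * ((M *v flow M x t) \<bullet> (N *v flow M x t))) (at t)" for t
    using bilinear_form_deriv[OF flow_has_vector_derivative[of M x t] flow_has_vector_derivative[of M x t], of N]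
    by (simp add: inner_symmetric[OF N, of "flow M x t"] inner_commute)
  have anti: "?f t \<le> ?f 0" if "t \<ge> 0" for t
    by (rule DERIV_nonpos_imp_nonincreasing[OF that]) (use d le in \<open>auto intro!: exI\<close>)
  have "0 \<le> ?f 0"
    by (rule tendsto_upperbound[OF bilinear_form_decay[OF M]])
      (use anti in \<open>auto simp: eventually_at_top_linorder\<close>)
  then show ?thesis by (simp add: flow_0)
qed

text \<open>The Lyapunov operator \<open>L\<close> is an injective linear map of a
  finite-dimensional space into itself, hence surjective. Symmetry of the solution follows from
  injectivity, semidefiniteness from \<open>lyapunov_nonneg\<close>.\<close>

lemma ex_lyapunov:
  fixes M W :: "real^'n^'n"
  assumes M: "stable M" and W: "pos_semidef W"
  shows "\<exists>P. pos_semidef P \<and> (\<forall>x. 2 * ((M *v x) \<bullet> (P *v x)) = - (x \<bullet> (W *v x)))"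
proof -
  define L where "L P = transpose M ** P + P ** M" for P
  have L_inner: "y \<bullet> (L P *v x) = (M *v y) \<bullet> (P *v x) + y \<bullet> (P *v (M *v x))" for P x y
    unfolding L_def matrix_vector_mult_add_rdistrib inner_add_right
    by (metis inner_commute inner_transpose_left matrix_vector_mul_assoc)
  have linL: "linear L"
    by (rule linearI) (simp_all add: L_def matrix_add_ldistrib matrix_matrix_mult_def vec_eq_iff
        algebra_simps sum.distrib sum_distrib_left)
  \<comment> \<open>If \<open>L P = 0\<close>, then the bilinear form of \<open>P\<close> is constant along trajectories, which decay to \<open>0\<close>.\<close>
  have inj: "P = 0" if "L P = 0" for P
  proof -
    have "y \<bullet> (P *v x) = 0" for x y
    proof -
      let ?f = "\<lambda>t. flow M y t \<bullet> (P *v flow M x t)"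
      have "(?f has_real_derivative 0) (at t)" for t
      proof -
        have "(?f has_real_derivative flow M y t \<bullet> (L P *v flow M x t)) (at t)"
          unfolding L_inner using bilinear_form_deriv[OF flow_has_vector_derivative[of M y t] flow_has_vector_derivative[of M x t], of P]
          by (simp add: add.commute)
        then show ?thesis by (simp add: that)
      qed
      then have "\<And>t. ?f t = ?f 0" using DERIV_isconst_all by blast
      then have "(?f \<longlongrightarrow> ?f 0) at_top" by (simp add: tendsto_eventually)
      then have "?f 0 = 0" using bilinear_form_decay[OF M] by (rule tendsto_unique[rotated]) simp
      then show ?thesis by (simp add: flow_0)
    qed
    then have "P *v x = 0 *v x" for x by (metis inner_eq_zero_iff matrix_vector_mult_0)
    then show ?thesis by (simp add: matrix_eq)
  qed
  have "inj L" using inj linL by (simp add: linear_injective_0)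
  then have "surj L" using linear_injective_imp_surjective[OF linL] by blast
  then obtain P where P: "L P = - W" by (metis surjD)
  \<comment> \<open>As \<open>W\<close> is symmetric, the transpose of \<open>P\<close> solves the
    same equation.\<close>
  have "L (transpose P) = transpose (L P)"
    by (simp add: L_def transpose_def matrix_matrix_mult_def vec_eq_iff algebra_simps)
  also have "\<dots> = - W" using W unfolding P pos_semidef_def by (simp add: transpose_def vec_eq_iff)
  finally have "L (transpose P - P) = 0" by (simp add: linear_diff[OF linL] P)
  then have sym: "transpose P = P" using inj by force
  have eq: "2 * ((M *v x) \<bullet> (P *v x)) = - (x \<bullet> (W *v x))" for x
  proof -
    have "- (x \<bullet> (W *v x)) = x \<bullet> (L P *v x)"
      by (simp add: P matrix_vector_mult_def inner_vec_def sum_negf)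
    also have "\<dots> = 2 * ((M *v x) \<bullet> (P *v x))"
      by (simp add: L_inner inner_symmetric[OF sym, of x] inner_commute)
    finally show ?thesis by simp
  qed
  have "0 \<le> x \<bullet> (P *v x)" for x
  proof (rule lyapunov_nonneg[OF M sym])
    show "(M *v x) \<bullet> (P *v x) \<le> 0" for x
      using eq[of x] W unfolding pos_semidef_def by (smt (verit))
  qed
  with eq sym show ?thesis unfolding pos_semidef_def by blast
qed

text \<open>Along the trajectory the running cost is the derivative of minus the form of
  \<open>P\<close>, which vanishes at infinity.\<close>

lemma integral_running_cost:
  fixes Q P :: "real^'n^'n" and K :: "real^'n^'m"
  assumes M: "stable (A + B ** K)" and P: "transpose P = P"
    and nn: "\<And>x. 0 \<le> running_cost Q R K x"
    and eq: "\<And>x. 2 * (((A + B ** K) *v x) \<bullet> (P *v x)) = - running_cost Q R K x"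
  shows "(LINT t:{0..}|lborel. running_cost Q R K (closed_loop_trajectory A B K \<xi> t)) = \<xi> \<bullet> (P *v \<xi>)"
proof -
  let ?M = "A + B ** K"
  let ?x = "flow ?M \<xi>"
  let ?f = "\<lambda>t. running_cost Q R K (?x t)"
  have d: "((\<lambda>t. - (?x t \<bullet> (P *v ?x t))) has_real_derivative ?f t) (at t)" for t
  proof -
    have "?f t = - (2 * ((?M *v ?x t) \<bullet> (P *v ?x t)))" using eq[of "?x t"] by simp
    then show ?thesis
      using DERIV_minus[OF bilinear_form_deriv[OF flow_has_vector_derivative[of ?M \<xi> t] flow_has_vector_derivative[of ?M \<xi> t], of P]]
      by (simp add: inner_symmetric[OF P, of "?x t"] inner_commute)
  qed
  have contx: "continuous_on UNIV ?x"
    by (meson flow_has_vector_derivative has_vector_derivative_continuous continuous_at_imp_continuous_on)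
  have "continuous_on UNIV ?f"
    unfolding running_cost_def
    by (intro continuous_intros bounded_linear.continuous_on[OF matrix_vector_mul_bounded_linear] contx)
  then have meas: "?f \<in> borel_measurable borel" by (rule borel_measurable_continuous_onI)
  have T: "((\<lambda>t. - (?x t \<bullet> (P *v ?x t))) \<longlongrightarrow> 0) at_top"
    using tendsto_minus[OF bilinear_form_decay[OF M]] by simp
  \<comment> \<open>Integrating in the extended nonnegative reals first delivers integrability
    together with the value.\<close>
  have "(\<integral>\<^sup>+t. ennreal (?f t) * indicator {0..} t \<partial>lborel) = ennreal (0 - - (?x 0 \<bullet> (P *v ?x 0)))"
    by (rule nn_integral_FTC_atLeast[OF meas _ _ T]) (use d nn in auto)
  then have nnI: "(\<integral>\<^sup>+t. ennreal (indicator {0..} t * ?f t) \<partial>lborel) = ennreal (\<xi> \<bullet> (P *v \<xi>))"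
    by (simp add: flow_0 ennreal_mult nn ennreal_indicator mult.commute)
  have pos: "0 \<le> \<xi> \<bullet> (P *v \<xi>)"
  proof (rule lyapunov_nonneg[OF M P])
    show "(?M *v x) \<bullet> (P *v x) \<le> 0" for x using eq[of x] nn[of x] by simp
  qed
  have "(LINT t:{0..}|lborel. running_cost Q R K (closed_loop_trajectory A B K \<xi> t))
      = (LINT t:{0..}|lborel. ?f t)"
    by (rule set_lebesgue_integral_cong) (auto simp: closed_loop_trajectory_eq)
  also have "\<dots> = (LINT t|lborel. indicator {0..} t * ?f t)"
    by (simp add: set_lebesgue_integral_def)
  also have "\<dots> = \<xi> \<bullet> (P *v \<xi>)"
    using meas nnI pos nn
    by (intro has_bochner_integral_integral_eq has_bochner_integral_nn_integral) auto
  finally show ?thesis .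
qed

section \<open>Positive semidefinite forms and eigenvalues\<close>

text \<open>The quadratic polynomial in \<open>t\<close> given by the form at
  \<open>z + t *\<^sub>R x\<close> is nonnegative, so its discriminant is not positive.\<close>

lemma pos_semidef_cauchy_schwarz:
  assumes "pos_semidef P"
  shows "(z \<bullet> (P *v x))\<^sup>2 \<le> (z \<bullet> (P *v z)) * (x \<bullet> (P *v x))"
proof -
  define a b c where "a = x \<bullet> (P *v x)" and "b = z \<bullet> (P *v x)" and "c = z \<bullet> (P *v z)"
  have sym: "transpose P = P" using assms by (simp add: pos_semidef_def)
  have ge: "0 \<le> c + 2 * t * b + t\<^sup>2 * a" for t
  proof -
    have "0 \<le> (z + t *\<^sub>R x) \<bullet> (P *v (z + t *\<^sub>R x))"
      using assms unfolding pos_semidef_def by blast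
    also have "\<dots> = c + 2 * t * b + t\<^sup>2 * a"
      by (simp add: a_def b_def c_def matrix_vector_right_distrib matrix_vector_mult_scaleR inner_add_left
          inner_add_right inner_symmetric[OF sym, of x z] inner_commute[of _ z]
          power2_eq_square algebra_simps)
    finally show ?thesis .
  qed
  have "0 \<le> a" using assms by (simp add: pos_semidef_def a_def)
  then consider "a = 0" | "a > 0" by linarith
  then have "b\<^sup>2 \<le> c * a"
  proof cases
    case 1
    \<comment> \<open>For \<open>a = 0\<close> the polynomial is affine, and at this
      \<open>t\<close> its value would be \<open>-1\<close>.\<close>
    then have "b = 0" using ge[of "- (c + 1) / (2 * b)"] by (cases "b = 0") (auto simp: field_simps)
    with 1 show ?thesis by simp
  next
    case 2
    have "c + 2 * (- b / a) * b + (- b / a)\<^sup>2 * a = c - b\<^sup>2 / a"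
      using 2 by (simp add: field_simps power2_eq_square)
    with ge[of "- b / a"] have "b\<^sup>2 / a \<le> c" by linarith
    with 2 show ?thesis by (simp add: field_simps)
  qed
  then show ?thesis by (simp add: a_def b_def c_def)
qed

text \<open>Cauchy-Schwarz against the vector \<open>P *v x\<close> itself.\<close>

lemma pos_semidef_kernel:
  assumes "pos_semidef P" and "x \<bullet> (P *v x) \<le> 0"
  shows "P *v x = 0"
proof -
  have "x \<bullet> (P *v x) = 0" using assms unfolding pos_semidef_def by (meson antisym)
  with pos_semidef_cauchy_schwarz[OF assms(1), of "P *v x" x] show ?thesis by simp
qed

lemma pos_def_imp_pos_semidef: "pos_def P \<Longrightarrow> pos_semidef P"
  unfolding pos_def_def pos_semidef_def by (metis inner_zero_left less_eq_real_def)

text \<open>The constant is the minimum of the form on the compact unit sphere; homogeneity extends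
  the bound to all vectors.\<close>

lemma pos_def_lower_bound:
  fixes P :: "real^'n^'n"
  assumes "pos_def P"
  obtains d where "d > 0" "\<And>y. d * (norm y)\<^sup>2 \<le> y \<bullet> (P *v y)"
proof -
  let ?f = "\<lambda>y. y \<bullet> (P *v y)"
  have "\<exists>u\<in>sphere 0 1. \<forall>y\<in>sphere 0 1. ?f u \<le> ?f y"
  proof (rule continuous_attains_inf)
    show "sphere (0::real^'n) 1 \<noteq> {}" by simp
    show "continuous_on (sphere 0 1) ?f" by (intro continuous_intros)
  qed simp
  then obtain u where u: "norm u = 1" "\<And>y. norm y = 1 \<Longrightarrow> ?f u \<le> ?f y" by auto
  show thesis
  proof
    show "?f u > 0" using assms u(1) unfolding pos_def_def by (metis norm_zero zero_neq_one)
    show "?f u * (norm y)\<^sup>2 \<le> ?f y" for y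
    proof (cases "y = 0")
      case False
      have "?f u \<le> ?f (y /\<^sub>R norm y)" using False by (intro u) simp
      also have "\<dots> = ?f y / (norm y)\<^sup>2"
        by (simp add: matrix_vector_mult_scaleR power2_eq_square field_simps)
      finally show ?thesis using False by (simp add: field_simps)
    qed simp
  qed
qed

section \<open>Spectra and norms of real matrices\<close>

text \<open>Here \<open>a\<close> and \<open>b\<close> are the real and imaginary parts of an
  eigenvector, so that complex eigenvalues can be combined with real quadratic forms.\<close>

lemma complex_eigenvalue_iff:
  "complex_eigenvalue M \<mu> \<longleftrightarrow> (\<exists>a b. (a \<noteq> 0 \<or> b \<noteq> 0) \<and>
     M *v a = Re \<mu> *\<^sub>R a - Im \<mu> *\<^sub>R b \<and> M *v b = Im \<mu> *\<^sub>R a + Re \<mu> *\<^sub>R b)"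
proof -
  let ?Mc = "map_matrix complex_of_real M"
  have *: "(?Mc *v v = \<mu> *s v) \<longleftrightarrow>
      M *v a = Re \<mu> *\<^sub>R a - Im \<mu> *\<^sub>R b \<and> M *v b = Im \<mu> *\<^sub>R a + Re \<mu> *\<^sub>R b"
    if a: "a = (\<chi> i. Re (v $ i))" and b: "b = (\<chi> i. Im (v $ i))" for a b v
    unfolding a b by (auto simp: vec_eq_iff complex_eq_iff matrix_vector_mult_def map_matrix_def)
  show ?thesis
  proof
    assume "complex_eigenvalue M \<mu>"
    then obtain v where v: "v \<noteq> 0" "?Mc *v v = \<mu> *s v" by (auto simp: complex_eigenvalue_def)
    let ?a = "\<chi> i. Re (v $ i)" and ?b = "\<chi> i. Im (v $ i)"
    have "?a \<noteq> 0 \<or> ?b \<noteq> 0" using v(1) by (auto simp: vec_eq_iff complex_eq_iff)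
    with v(2) *[OF refl refl, of v] show "\<exists>a b. (a \<noteq> 0 \<or> b \<noteq> 0) \<and>
     M *v a = Re \<mu> *\<^sub>R a - Im \<mu> *\<^sub>R b \<and> M *v b = Im \<mu> *\<^sub>R a + Re \<mu> *\<^sub>R b" by blast
  next
    assume "\<exists>a b. (a \<noteq> 0 \<or> b \<noteq> 0) \<and>
     M *v a = Re \<mu> *\<^sub>R a - Im \<mu> *\<^sub>R b \<and> M *v b = Im \<mu> *\<^sub>R a + Re \<mu> *\<^sub>R b"
    then obtain a b where ab: "a \<noteq> 0 \<or> b \<noteq> 0"
     "M *v a = Re \<mu> *\<^sub>R a - Im \<mu> *\<^sub>R b" "M *v b = Im \<mu> *\<^sub>R a + Re \<mu> *\<^sub>R b" by blast
    let ?v = "\<chi> i. Complex (a $ i) (b $ i)"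
    have "?v \<noteq> 0" using ab(1) by (auto simp: vec_eq_iff complex_eq_iff)
    moreover have "?Mc *v ?v = \<mu> *s ?v" using *[of a ?v b] ab by (simp add: vec_eq_iff)
    ultimately show "complex_eigenvalue M \<mu>" unfolding complex_eigenvalue_def by blast
  qed
qed

lemma mat_mult_vec: "mat c *v x = c *\<^sub>R (x :: real^'n)"
  by (simp add: vec_eq_iff matrix_vector_mult_def mat_def if_distrib if_distribR cong: if_cong)

lemma damped_mult_vec: "damped A \<alpha> *v x = A *v x - \<alpha> *\<^sub>R x"
  by (simp add: damped_def matrix_vector_mult_diff_rdistrib mat_mult_vec)

text \<open>Raising the damping by \<open>\<beta> - \<alpha>\<close> translates the spectrum to the
  left by that amount.\<close>

lemma stable_damped_mono:
  assumes st: "stable (damped A \<alpha> + X)" and le: "\<alpha> \<le> \<beta>"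
  shows "stable (damped A \<beta> + X)"
  unfolding stable_def
proof (intro allI impI)
  fix \<mu> assume "complex_eigenvalue (damped A \<beta> + X) \<mu>"
  then have "complex_eigenvalue (damped A \<alpha> + X) (\<mu> + of_real (\<beta> - \<alpha>))"
    unfolding complex_eigenvalue_iff
    by (elim ex_forward conj_forward)
      (auto simp: damped_mult_vec matrix_vector_mult_add_rdistrib algebra_simps)
  with st le show "Re \<mu> < 0" unfolding stable_def by fastforce
qed

text \<open>Turns operator bounds into bounds for the norm in which bounded sequences have
  convergent subsequences.\<close>

lemma norm_matrix_le_onorm:
  fixes X :: "real^'n^'m"
  shows "norm X \<le> real CARD('m) * real CARD('n) * onorm ((*v) X)"
proof -
  have "norm X \<le> (\<Sum>i\<in>UNIV. norm (X $ i))"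
    unfolding norm_vec_def by (rule L2_set_le_sum) simp
  also have "\<dots> \<le> (\<Sum>i\<in>UNIV. \<Sum>j\<in>UNIV. \<bar>X $ i $ j\<bar>)"
    by (intro sum_mono norm_le_l1_cart)
  also have "\<dots> \<le> (\<Sum>i\<in>(UNIV::'m set). \<Sum>j\<in>(UNIV::'n set). onorm ((*v) X))"
    by (intro sum_mono matrix_component_le_onorm)
  finally show ?thesis by simp
qed

section \<open>The cost of feasible gains\<close>

text \<open>Detectability serves to deduce stability from a Lyapunov inequality
  (\<open>feasibleI\<close>); \<open>Q \<noteq> 0\<close> makes the decrease of the cost
  strict.\<close>

locale lqr = prob_space M
  for M :: "'w measure" and x0 :: "'w \<Rightarrow> real^'n"
    and A :: "real^'n^'n" and B :: "real^'m^'n"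
    and Q D0 :: "real^'n^'n" and R :: "real^'m^'m"
    and S :: "(real^'n^'m) set" +
  assumes Q: "pos_semidef Q" and R: "pos_def R" and D0: "pos_def D0"
    and S: "subspace S"
    and covariance: "has_bochner_integral M (\<lambda>\<omega>. \<chi> i j. x0 \<omega> $ i * x0 \<omega> $ j) D0"
    and detectable: "detectable A Q" and Q_nonzero: "Q \<noteq> 0"
begin

abbreviation "F \<equiv> feasible_gains A B S"
abbreviation "J K \<alpha> \<equiv> lqr_cost M x0 A B Q R K \<alpha>"
abbreviation "rc \<equiv> running_cost Q R"
abbreviation "cl K \<alpha> x \<equiv> (damped A \<alpha> + B ** K) *v x"

lemma cl_eq: "cl K \<alpha> x = A *v x + B *v (K *v x) - \<alpha> *\<^sub>R x"
  by (simp add: damped_mult_vec matrix_vector_mult_add_rdistrib matrix_vector_mul_assoc)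

lemma cl_shift: "cl K \<beta> x = cl K \<alpha> x + (\<alpha> - \<beta>) *\<^sub>R x"
  by (simp only: cl_eq) (simp add: scaleR_diff_left)

lemma rc_nonneg: "0 \<le> rc K x"
  using Q pos_def_imp_pos_semidef[OF R] by (simp add: running_cost_def pos_semidef_def)

lemma pos_semidef_cost_matrix: "pos_semidef (Q + transpose K ** R ** K)"
  and rc_eq: "x \<bullet> ((Q + transpose K ** R ** K) *v x) = rc K x"
proof -
  have *: "x \<bullet> ((Q + transpose K ** R ** K) *v x) = rc K x" for x
    unfolding running_cost_def matrix_vector_mult_add_rdistrib inner_add_right
      matrix_vector_mul_assoc[symmetric] 
    by (metis inner_commute inner_transpose_left)
  then show "x \<bullet> ((Q + transpose K ** R ** K) *v x) = rc K x" .
  have "transpose (Q + transpose K ** R ** K) = transpose Q + transpose (transpose K ** R ** K)"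
    by (simp add: transpose_def vec_eq_iff)
  also have "\<dots> = Q + transpose K ** R ** K"
    using Q R unfolding pos_semidef_def pos_def_def by (simp add: matrix_transpose_mul matrix_mul_assoc)
  finally show "pos_semidef (Q + transpose K ** R ** K)"
    unfolding pos_semidef_def using * rc_nonneg by simp
qed

text \<open>A quadratic form is a linear functional of the outer product of its argument, so it
  commutes with expectation. As \<open>D0\<close> is symmetric, \<open>D0 \<bullet> P\<close> is the
  trace of \<open>D0 ** P\<close>.\<close>

lemma expectation_form:
  "has_bochner_integral M (\<lambda>\<omega>. x0 \<omega> \<bullet> (P *v x0 \<omega>)) (D0 \<bullet> P)"
proof -
  have "(\<chi> i j. x $ i * x $ j) \<bullet> P = x \<bullet> (P *v x)" for x :: "real^'n"
    by (simp add: inner_vec_def matrix_vector_mult_def sum_distrib_left algebra_simps)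
  with has_bochner_integral_bounded_linear[OF bounded_linear_inner_left covariance, of P]
  show ?thesis by simp
qed

lemma trace_nonneg: "pos_semidef P \<Longrightarrow> 0 \<le> D0 \<bullet> P"
  using expectation_form[of P] integral_nonneg_AE[of "\<lambda>\<omega>. x0 \<omega> \<bullet> (P *v x0 \<omega>)" M]
  by (simp add: has_bochner_integral_iff pos_semidef_def)

text \<open>
  The left-hand side is the second moment of \<open>x0 \<bullet> (P *v z)\<close>, to which the Cauchy-Schwarz inequality
  for \<open>P\<close> is applied pointwise.
\<close>
lemma trace_dominates:
  assumes P: "pos_semidef P"
  shows "(P *v z) \<bullet> (D0 *v (P *v z)) \<le> (z \<bullet> (P *v z)) * (D0 \<bullet> P)"
proof -
  define y where "y = P *v z"
  let ?Y = "\<chi> i j. y $ i * y $ j"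
  have "D0 \<bullet> ?Y = y \<bullet> (D0 *v y)"
    by (simp add: inner_vec_def matrix_vector_mult_def sum_distrib_left algebra_simps)
  moreover have "x \<bullet> (?Y *v x) = (x \<bullet> y)\<^sup>2" for x
  proof -
    have "?Y *v x = (y \<bullet> x) *\<^sub>R y"
      by (simp add: vec_eq_iff inner_vec_def matrix_vector_mult_def sum_distrib_left algebra_simps)
    then show ?thesis by (simp add: power2_eq_square inner_commute)
  qed
  ultimately have "has_bochner_integral M (\<lambda>\<omega>. (x0 \<omega> \<bullet> y)\<^sup>2) (y \<bullet> (D0 *v y))"
    using expectation_form[of ?Y] by simp
  moreover have "has_bochner_integral M (\<lambda>\<omega>. (z \<bullet> (P *v z)) * (x0 \<omega> \<bullet> (P *v x0 \<omega>)))
      ((z \<bullet> (P *v z)) * (D0 \<bullet> P))"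
    by (intro has_bochner_integral_mult_right expectation_form)
  moreover have "(x \<bullet> y)\<^sup>2 \<le> (z \<bullet> (P *v z)) * (x \<bullet> (P *v x))" for x
    using pos_semidef_cauchy_schwarz[OF P, of x z] by (simp add: y_def mult.commute)
  ultimately show ?thesis unfolding y_def
    by (metis (no_types, lifting) has_bochner_integral_iff integral_mono)
qed

text \<open>With \<open>d\<close> a lower bound for the form of \<open>D0\<close>,
  \<open>trace_dominates\<close> bounds \<open>d * (norm (P *v z))\<^sup>2\<close>, and one factor
  \<open>norm (P *v z)\<close> cancels. The same \<open>d\<close> serves all
  \<open>P\<close>.\<close>

lemma ex_trace_norm_bound:
  obtains d where "d > 0" "\<And>(P :: real^'n^'n) z. pos_semidef P \<Longrightarrow> norm (P *v z) \<le> (D0 \<bullet> P) / d * norm z"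
proof -
  obtain d where d: "d > 0" "\<And>y. d * (norm y)\<^sup>2 \<le> y \<bullet> (D0 *v y)"
    using pos_def_lower_bound[OF D0] by blast
  show thesis
  proof
    show "d > 0" by fact
    fix P :: "real^'n^'n" and z assume P: "pos_semidef P"
    have "d * (norm (P *v z))\<^sup>2 \<le> (z \<bullet> (P *v z)) * (D0 \<bullet> P)"
      using d(2) trace_dominates[OF P] order_trans by blast
    also have "\<dots> \<le> (norm z * norm (P *v z)) * (D0 \<bullet> P)"
      by (intro mult_right_mono norm_cauchy_schwarz trace_nonneg P)
    finally have "norm (P *v z) * (d * norm (P *v z)) \<le> norm (P *v z) * (norm z * (D0 \<bullet> P))"
      by (simp add: power2_eq_square algebra_simps)
    then have "d * norm (P *v z) \<le> norm z * (D0 \<bullet> P)"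
      using trace_nonneg[OF P] by (cases "P *v z = 0") auto
    then show "norm (P *v z) \<le> (D0 \<bullet> P) / d * norm z"
      using d(1) by (simp add: field_simps)
  qed
qed

section \<open>Lyapunov solutions, feasibility and comparison of costs\<close>

text \<open>The Lyapunov equation stated through its quadratic form; by symmetry of \<open>P\<close>
  its two mixed terms coincide, whence the factor 2.\<close>

definition lyap :: "real^'n^'m \<Rightarrow> real \<Rightarrow> real^'n^'n \<Rightarrow> bool" where
  "lyap K \<alpha> P \<longleftrightarrow> pos_semidef P \<and> (\<forall>x. 2 * (cl K \<alpha> x \<bullet> (P *v x)) = - rc K x)"

lemma lyap_cost:
  assumes "K \<in> F \<alpha>" and P: "lyap K \<alpha> P"
  shows "J K \<alpha> = D0 \<bullet> P"
proof -
  have "(LINT t:{0..}|lborel. rc K (closed_loop_trajectory (damped A \<alpha>) B K \<xi> t)) = \<xi> \<bullet> (P *v \<xi>)" for \<xi>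
    using assms rc_nonneg
    by (intro integral_running_cost) (auto simp: lyap_def pos_semidef_def feasible_gains_def)
  then show ?thesis
    unfolding lqr_cost_def using expectation_form[of P] by (simp add: has_bochner_integral_iff)
qed

lemma ex_lyap:
  assumes "K \<in> F \<alpha>"
  obtains P where "lyap K \<alpha> P" "J K \<alpha> = D0 \<bullet> P"
proof -
  have "\<exists>P. lyap K \<alpha> P"
    using ex_lyapunov[OF _ pos_semidef_cost_matrix] assms
    unfolding lyap_def rc_eq feasible_gains_def by blast
  with lyap_cost[OF assms] that show thesis by blast
qed

text \<open>For an eigenvalue with nonnegative real part, the inequality forces the running cost to
  vanish on the eigenvector, so \<open>Q\<close> and \<open>K\<close> annihilate it. Then
  \<open>A + L ** Q\<close> has the eigenvalue \<open>\<mu> + \<alpha>\<close>, against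
  detectability; this is where \<open>0 \<le> \<alpha>\<close> enters.\<close>

lemma feasibleI:
  assumes K: "K \<in> S" and \<alpha>: "0 \<le> \<alpha>" and P: "pos_semidef P"
    and le: "\<And>x. 2 * (cl K \<alpha> x \<bullet> (P *v x)) \<le> - rc K x"
  shows "K \<in> F \<alpha>"
proof -
  have "Re \<mu> < 0" if ev: "complex_eigenvalue (damped A \<alpha> + B ** K) \<mu>" for \<mu>
  proof (rule ccontr)
    assume neg: "\<not> Re \<mu> < 0"
    obtain a b where ab: "a \<noteq> 0 \<or> b \<noteq> 0" "cl K \<alpha> a = Re \<mu> *\<^sub>R a - Im \<mu> *\<^sub>R b"
      "cl K \<alpha> b = Im \<mu> *\<^sub>R a + Re \<mu> *\<^sub>R b"
      using ev unfolding complex_eigenvalue_iff by blast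
    \<comment> \<open>Symmetry of \<open>P\<close> cancels the cross terms carrying
      \<open>Im \<mu>\<close>.\<close>
    have "b \<bullet> (P *v a) = a \<bullet> (P *v b)"
      using P unfolding pos_semidef_def by (metis inner_commute inner_symmetric)
    then have "cl K \<alpha> a \<bullet> (P *v a) + cl K \<alpha> b \<bullet> (P *v b)
        = Re \<mu> * (a \<bullet> (P *v a) + b \<bullet> (P *v b))"
      unfolding ab by (simp add: inner_diff_left inner_add_left algebra_simps)
    also have "\<dots> \<ge> 0" using P neg unfolding pos_semidef_def by simp
    finally have rc0: "rc K a = 0" "rc K b = 0"
      using le[of a] le[of b] rc_nonneg[of K a] rc_nonneg[of K b] by linarith+
    have zero: "Q *v x = 0 \<and> K *v x = 0" if "rc K x = 0" for x
    proof -
      have "0 \<le> x \<bullet> (Q *v x)" "0 \<le> (K *v x) \<bullet> (R *v (K *v x))"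
        using Q pos_def_imp_pos_semidef[OF R] by (auto simp: pos_semidef_def)
      with that have "x \<bullet> (Q *v x) \<le> 0" "(K *v x) \<bullet> (R *v (K *v x)) \<le> 0"
        unfolding running_cost_def by linarith+
      with pos_semidef_kernel[OF Q] R show ?thesis unfolding pos_def_def by (meson not_le)
    qed
    obtain L where L: "stable (A + L ** Q)" using detectable by (auto simp: detectable_def)
    have "(A + L ** Q) *v x = cl K \<alpha> x + \<alpha> *\<^sub>R x" if "rc K x = 0" for x
      using zero[OF that]
      by (simp only: cl_eq) (simp add: matrix_vector_mult_add_rdistrib flip: matrix_vector_mul_assoc)
    then have "(A + L ** Q) *v a = (Re \<mu> + \<alpha>) *\<^sub>R a - Im \<mu> *\<^sub>R b"
      "(A + L ** Q) *v b = Im \<mu> *\<^sub>R a + (Re \<mu> + \<alpha>) *\<^sub>R b"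
      using rc0 ab by (simp_all add: algebra_simps)
    with ab(1) have "complex_eigenvalue (A + L ** Q) (\<mu> + of_real \<alpha>)"
      unfolding complex_eigenvalue_iff by auto
    with L \<alpha> neg show False unfolding stable_def by fastforce
  qed
  with K show ?thesis unfolding feasible_gains_def stable_def by blast
qed

text \<open>Subtracting the equation for \<open>P\<close> from the inequality for \<open>N\<close>
  leaves the hypothesis of \<open>lyapunov_nonneg\<close> for \<open>N - P\<close>.\<close>

lemma cost_le:
  assumes K: "K \<in> F \<alpha>" and N: "pos_semidef N"
    and le: "\<And>x. 2 * (cl K \<alpha> x \<bullet> (N *v x)) \<le> - rc K x"
  shows "J K \<alpha> \<le> D0 \<bullet> N"
proof -
  obtain P where P: "lyap K \<alpha> P" "J K \<alpha> = D0 \<bullet> P" using ex_lyap[OF K] .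
  have sym: "transpose (N - P) = N - P"
    using N P(1) unfolding lyap_def pos_semidef_def by (simp add: transpose_def vec_eq_iff)
  have "0 \<le> x \<bullet> ((N - P) *v x)" for x
  proof (rule lyapunov_nonneg[OF _ sym])
    show "stable (damped A \<alpha> + B ** K)" using K by (simp add: feasible_gains_def)
    show "cl K \<alpha> x \<bullet> ((N - P) *v x) \<le> 0" for x
      using le[of x] P(1) unfolding lyap_def matrix_vector_mult_diff_rdistrib inner_diff_right
      by (smt (verit))
  qed
  with sym have "pos_semidef (N - P)" unfolding pos_semidef_def by blast
  from trace_nonneg[OF this] P(2) show ?thesis by (simp add: inner_diff_right)
qed

lemma cost_nonneg: "K \<in> F \<alpha> \<Longrightarrow> 0 \<le> J K \<alpha>"
  by (metis ex_lyap lyap_def trace_nonneg)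

lemma feasible_mono: "K \<in> F \<alpha> \<Longrightarrow> \<alpha> \<le> \<beta> \<Longrightarrow> K \<in> F \<beta>"
  unfolding feasible_gains_def using stable_damped_mono by blast

text \<open>\<open>P - P'\<close> is positive semidefinite. If the costs did not drop, its trace
  against \<open>D0\<close> would vanish, so \<open>P = P'\<close>; then \<open>P\<close>, the
  running cost and finally \<open>Q\<close> would be zero.\<close>

lemma cost_strict_antimono:
  assumes K: "K \<in> F \<alpha>" and less: "\<alpha> < \<beta>"
  shows "J K \<beta> < J K \<alpha>"
proof (rule ccontr)
  assume ge: "\<not> J K \<beta> < J K \<alpha>"
  have K': "K \<in> F \<beta>" using feasible_mono[OF K] less by simp
  obtain P where P: "lyap K \<alpha> P" "J K \<alpha> = D0 \<bullet> P" using ex_lyap[OF K] .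
  obtain P' where P': "lyap K \<beta> P'" "J K \<beta> = D0 \<bullet> P'" using ex_lyap[OF K'] .
  let ?N = "P - P'"
  have sym: "transpose ?N = ?N"
    using P P' unfolding lyap_def pos_semidef_def by (simp add: transpose_def vec_eq_iff)
  \<comment> \<open>Writing the equation for \<open>P\<close> with damping \<open>\<beta>\<close>
    leaves a residue proportional to the form of \<open>P\<close>.\<close>
  have eq: "cl K \<beta> x \<bullet> (?N *v x) = - ((\<beta> - \<alpha>) * (x \<bullet> (P *v x)))" for x
  proof -
    have "2 * (cl K \<beta> x \<bullet> (P *v x)) = - rc K x - 2 * ((\<beta> - \<alpha>) * (x \<bullet> (P *v x)))"
      using P(1) unfolding lyap_def cl_shift[where \<alpha> = \<alpha> and \<beta> = \<beta>] inner_add_left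
      by (simp add: algebra_simps)
    moreover have "2 * (cl K \<beta> x \<bullet> (P' *v x)) = - rc K x" using P'(1) by (simp add: lyap_def)
    ultimately show ?thesis
      unfolding matrix_vector_mult_diff_rdistrib inner_diff_right by linarith
  qed
  have "0 \<le> x \<bullet> (?N *v x)" for x
  proof (rule lyapunov_nonneg[OF _ sym])
    show "stable (damped A \<beta> + B ** K)" using K' by (simp add: feasible_gains_def)
    show "cl K \<beta> x \<bullet> (?N *v x) \<le> 0" for x
      unfolding eq using P(1) less by (simp add: lyap_def pos_semidef_def mult_nonneg_nonneg)
  qed
  with sym have N: "pos_semidef ?N" unfolding pos_semidef_def by blast
  have "D0 \<bullet> ?N = 0" using trace_nonneg[OF N] ge P(2) P'(2) by (simp add: inner_diff_right)
  with ex_trace_norm_bound N have N0: "?N *v x = 0" for x by (metis divide_eq_0_iff mult_zero_left norm_le_zero_iff)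
  have "Q *v x = 0" for x
  proof -
    have "x \<bullet> (P *v x) \<le> 0" using eq[of x] less by (simp add: N0)
    then have "P *v x = 0" using P(1) by (intro pos_semidef_kernel) (auto simp: lyap_def)
    then have "rc K x = 0" using P(1) unfolding lyap_def
      by (metis inner_zero_right mult_zero_right neg_equal_0_iff_equal)
    moreover have "0 \<le> (K *v x) \<bullet> (R *v (K *v x))"
      using pos_def_imp_pos_semidef[OF R] by (simp add: pos_semidef_def)
    ultimately have "x \<bullet> (Q *v x) \<le> 0" unfolding running_cost_def by linarith
    then show ?thesis by (rule pos_semidef_kernel[OF Q])
  qed
  with Q_nonzero show False by (metis matrix_eq matrix_vector_mult_0)
qed

text \<open>The content lies in dampings below \<open>a\<close>, where feasibility could be lost: a
  strict Lyapunov inequality at \<open>a\<close> persists nearby, giving feasibility by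
  \<open>feasibleI\<close> and the cost bound by \<open>cost_le\<close>.\<close>

lemma cost_upper_semicontinuous:
  assumes K: "K \<in> F a" and e: "e > 0"
  obtains \<delta> where "\<delta> > 0"
    "\<And>\<alpha>. 0 \<le> \<alpha> \<Longrightarrow> \<bar>\<alpha> - a\<bar> < \<delta> \<Longrightarrow> K \<in> F \<alpha> \<and> J K \<alpha> \<le> J K a + e"
proof -
  obtain P where P: "lyap K a P" "J K a = D0 \<bullet> P" using ex_lyap[OF K] .
  have "pos_semidef (mat 1 :: real^'n^'n)" by (simp add: pos_semidef_def)
  with ex_lyapunov[of "damped A a + B ** K" "mat 1"] K obtain P1 where
    P1: "pos_semidef P1" "\<And>x. 2 * (cl K a x \<bullet> (P1 *v x)) = - (x \<bullet> x)"
    unfolding feasible_gains_def by auto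
  \<comment> \<open>Chosen so that the perturbation costs at most \<open>e\<close>; the
    \<open>+ 1\<close> excludes a zero denominator.\<close>
  define \<theta> where "\<theta> = e / (D0 \<bullet> P1 + 1)"
  have tr: "0 < D0 \<bullet> P1 + 1" using trace_nonneg[OF P1(1)] by linarith
  then have \<theta>: "\<theta> > 0" using e by (simp add: \<theta>_def)
  \<comment> \<open>The extra \<open>\<theta> P1\<close> leaves room in the Lyapunov inequality to absorb a small change of damping.\<close>
  let ?N = "P + \<theta> *\<^sub>R P1"
  have Nx: "?N *v x = P *v x + \<theta> *\<^sub>R (P1 *v x)" for x
    by (simp add: matrix_vector_mult_add_rdistrib scaleR_matrix_vector_assoc)
  have N: "pos_semidef ?N"
  proof -
    have "transpose ?N = ?N"
      using P(1) P1(1) by (simp add: lyap_def pos_semidef_def transpose_def vec_eq_iff)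
    then show ?thesis
      using P(1) P1(1) \<theta> unfolding lyap_def pos_semidef_def Nx by (simp add: inner_add_right)
  qed
  let ?c = "onorm ((*v) ?N)"
  have c: "0 \<le> ?c" by (intro onorm_pos_le) simp
  show thesis
  proof
    show "\<theta> / (2 * (?c + 1)) > 0" using \<theta> c by simp
    fix \<alpha> :: real assume \<alpha>: "0 \<le> \<alpha>" "\<bar>\<alpha> - a\<bar> < \<theta> / (2 * (?c + 1))"
    have le: "2 * (cl K \<alpha> x \<bullet> (?N *v x)) \<le> - rc K x" for x
    proof -
      have "2 * (cl K \<alpha> x \<bullet> (?N *v x)) = 2 * (cl K a x \<bullet> (P *v x)) + \<theta> * (2 * (cl K a x \<bullet> (P1 *v x)))
          + 2 * (a - \<alpha>) * (x \<bullet> (?N *v x))"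
        unfolding cl_shift[where \<alpha> = a and \<beta> = \<alpha>] Nx by (simp add: inner_add_left inner_add_right algebra_simps)
      also have "\<dots> = - rc K x - \<theta> * (x \<bullet> x) + 2 * (a - \<alpha>) * (x \<bullet> (?N *v x))"
        using P(1) unfolding P1(2) lyap_def by simp
      also have "2 * (a - \<alpha>) * (x \<bullet> (?N *v x)) \<le> 2 * \<bar>\<alpha> - a\<bar> * ((?c + 1) * (x \<bullet> x))"
      proof -
        have "\<bar>x \<bullet> (?N *v x)\<bar> \<le> norm x * norm (?N *v x)" by (rule Cauchy_Schwarz_ineq2)
        also have "\<dots> \<le> norm x * (?c * norm x)" by (intro mult_left_mono onorm) auto
        also have "\<dots> \<le> (?c + 1) * (x \<bullet> x)"
          by (simp add: power2_norm_eq_inner[symmetric] power2_eq_square algebra_simps)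
        finally have "\<bar>2 * (a - \<alpha>)\<bar> * \<bar>x \<bullet> (?N *v x)\<bar> \<le> \<bar>2 * (a - \<alpha>)\<bar> * ((?c + 1) * (x \<bullet> x))"
          by (rule mult_left_mono) simp
        moreover have "2 * (a - \<alpha>) * (x \<bullet> (?N *v x)) \<le> \<bar>2 * (a - \<alpha>)\<bar> * \<bar>x \<bullet> (?N *v x)\<bar>"
          by (metis abs_ge_self abs_mult)
        moreover have "\<bar>2 * (a - \<alpha>)\<bar> = 2 * \<bar>\<alpha> - a\<bar>"
          by (metis abs_minus_commute abs_mult abs_numeral)
        ultimately show ?thesis by simp
      qed
      also have "2 * \<bar>\<alpha> - a\<bar> * ((?c + 1) * (x \<bullet> x)) \<le> \<theta> * (x \<bullet> x)"
      proof -
        have "2 * \<bar>\<alpha> - a\<bar> * (?c + 1) \<le> \<theta>" using \<alpha>(2) c by (simp add: field_simps)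
        from mult_right_mono[OF this inner_ge_zero[of x]] show ?thesis by (simp add: mult.assoc)
      qed
      finally show ?thesis by simp
    qed
    have K': "K \<in> F \<alpha>" using feasibleI[OF _ \<alpha>(1) N le] K by (simp add: feasible_gains_def)
    have "J K \<alpha> \<le> D0 \<bullet> ?N" by (rule cost_le[OF K' N le])
    also have "\<dots> = J K a + \<theta> * (D0 \<bullet> P1)" by (simp add: P(2) inner_add_right)
    also have "\<theta> * (D0 \<bullet> P1) \<le> e" using tr e by (simp add: \<theta>_def field_simps)
    finally show "K \<in> F \<alpha> \<and> J K \<alpha> \<le> J K a + e" using K' by simp
  qed
qed

end

section \<open>Compactness of sublevel sets and optimal gains\<close>

lemma tendsto_matrix_vector:
  fixes X :: "nat \<Rightarrow> real^'a^'b"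
  assumes "X \<longlonglongrightarrow> Y"
  shows "(\<lambda>k. X k *v x) \<longlonglongrightarrow> Y *v x"
  unfolding matrix_vector_mult_def using assms
  by (intro vec_tendstoI) (auto intro!: tendsto_intros)

text \<open>Turns failure of a neighbourhood condition into a sequence, so that compactness can be
  used.\<close>

lemma sequence_into:
  fixes a :: real
  assumes "\<And>\<delta>. \<delta> > 0 \<Longrightarrow> \<exists>x\<ge>0. \<bar>x - a\<bar> < \<delta> \<and> Pr x"
  obtains \<alpha> where "\<alpha> \<longlonglongrightarrow> a" "\<And>k::nat. 0 \<le> \<alpha> k" "\<And>k. Pr (\<alpha> k)"
proof -
  have "\<exists>x\<ge>0. \<bar>x - a\<bar> < 1 / real (Suc k) \<and> Pr x" for k by (rule assms) simp
  then obtain \<alpha> where \<alpha>: "\<And>k. 0 \<le> \<alpha> k" "\<And>k. \<bar>\<alpha> k - a\<bar> < 1 / real (Suc k)" "\<And>k. Pr (\<alpha> k)"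
    by metis
  have "(\<lambda>k. \<alpha> k - a) \<longlonglongrightarrow> 0"
    by (rule Lim_null_comparison[OF _ LIMSEQ_inverse_real_of_nat])
      (use \<alpha>(2) less_imp_le in \<open>auto simp: inverse_eq_divide intro!: always_eventually\<close>)
  then have "\<alpha> \<longlonglongrightarrow> a" by (simp add: LIM_zero_iff)
  with that \<alpha> show thesis by blast
qed

context lqr
begin

text \<open>For \<open>k\<close> the operator norm of \<open>K\<close>, the equation yields
  \<open>k\<^sup>2 \<le> c1 + c2 * k\<close>: the left side comes from \<open>R\<close>,
  \<open>c1\<close> from \<open>A\<close> and the damping, \<open>c2\<close> from
  \<open>B ** K\<close>.\<close>

lemma lyap_gain_bound:
  obtains b where "\<And>K \<alpha> P. lyap K \<alpha> P \<Longrightarrow> \<bar>\<alpha>\<bar> \<le> u \<Longrightarrow> onorm ((*v) P) \<le> p \<Longrightarrow> onorm ((*v) K) \<le> b"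
proof -
  obtain r where r: "r > 0" "\<And>y. r * (norm y)\<^sup>2 \<le> y \<bullet> (R *v y)"
    using pos_def_lower_bound[OF R] by blast
  let ?a = "onorm ((*v) A)" and ?b = "onorm ((*v) B)"
  have ab: "0 \<le> ?a" "0 \<le> ?b" by (simp_all add: onorm_pos_le)
  \<comment> \<open>Absolute values keep the constants nonnegative before any triple satisfying the
    bounds is given.\<close>
  define c1 where "c1 = 2 * \<bar>p\<bar> * (?a + \<bar>u\<bar>) / r"
  define c2 where "c2 = 2 * \<bar>p\<bar> * ?b / r"
  have c: "0 \<le> c1" "0 \<le> c2" using ab r(1) by (simp_all add: c1_def c2_def)
  have "onorm ((*v) K) \<le> 1 + c1 + c2"
    if P: "lyap K \<alpha> P" and u: "\<bar>\<alpha>\<bar> \<le> u" and p: "onorm ((*v) P) \<le> p" for K :: "real^'n^'m" and \<alpha> P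
  proof -
    let ?k = "onorm ((*v) K)"
    have k: "0 \<le> ?k" by (simp add: onorm_pos_le)
    have p0: "0 \<le> p" using p onorm_pos_le[OF matrix_vector_mul_bounded_linear, of P] by linarith
    have sq: "(norm (K *v z))\<^sup>2 \<le> (c1 + c2 * ?k) * (norm z)\<^sup>2" for z
    proof -
      have cl: "norm (cl K \<alpha> z) \<le> (?a + u + ?b * ?k) * norm z"
      proof -
        have "norm (cl K \<alpha> z) \<le> norm (A *v z) + norm (B *v (K *v z)) + norm (\<alpha> *\<^sub>R z)"
          unfolding cl_eq by (intro order_trans[OF norm_triangle_ineq4] add_right_mono norm_triangle_ineq)
        also have "\<dots> \<le> ?a * norm z + ?b * (?k * norm z) + u * norm z"
          by (intro add_mono order_trans[OF onorm[OF matrix_vector_mul_bounded_linear] mult_left_mono]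
              onorm[OF matrix_vector_mul_bounded_linear] ab)
            (use u in \<open>simp add: mult_right_mono\<close>)
        finally show ?thesis by (simp add: algebra_simps)
      qed
      have Pz: "norm (P *v z) \<le> p * norm z"
        using onorm[OF matrix_vector_mul_bounded_linear, of P z] mult_right_mono[OF p, of "norm z"] by simp
      have "r * (norm (K *v z))\<^sup>2 \<le> (K *v z) \<bullet> (R *v (K *v z))" by (rule r)
      also have "\<dots> \<le> rc K z" using Q by (simp add: running_cost_def pos_semidef_def)
      also have "\<dots> = - (2 * (cl K \<alpha> z \<bullet> (P *v z)))" using P unfolding lyap_def by auto
      also have "\<dots> \<le> 2 * (norm (cl K \<alpha> z) * norm (P *v z))"
        using Cauchy_Schwarz_ineq2[of "cl K \<alpha> z" "P *v z"] by linarith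
      also have "\<dots> \<le> 2 * (((?a + u + ?b * ?k) * norm z) * (p * norm z))"
        using u k ab p0 by (intro mult_left_mono mult_mono cl Pz) auto
      also have "\<dots> = r * ((c1 + c2 * ?k) * (norm z)\<^sup>2)"
        using r(1) p0 u by (simp add: c1_def c2_def power2_eq_square field_simps)
      finally show ?thesis using r(1) by simp
    qed
    have "norm (K *v z) \<le> sqrt (c1 + c2 * ?k) * norm z" for z
      using real_sqrt_le_mono[OF sq[of z]] by (simp add: real_sqrt_mult)
    then have "?k \<le> sqrt (c1 + c2 * ?k)" by (rule onorm_le)
    then have "?k\<^sup>2 \<le> c1 + c2 * ?k" using k c by (simp add: real_le_rsqrt sqrt_ge_absD)
    show ?thesis
    proof (rule ccontr)
      assume "\<not> ?thesis"
      then have g: "1 + c1 + c2 < ?k" by simp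
      then have "?k * (1 + c1 + c2) \<le> ?k * ?k" using k by (intro mult_left_mono) auto
      moreover have "c1 * 1 \<le> c1 * ?k" using g c by (intro mult_left_mono) auto
      ultimately have "?k \<le> 0" using \<open>?k\<^sup>2 \<le> c1 + c2 * ?k\<close>
        by (simp add: power2_eq_square algebra_simps)
      with g c show False by linarith
    qed
  qed
  with that show thesis by blast
qed

text \<open>Gains and Lyapunov solutions are bounded, so a subsequence of the pairs converges and
  the equation passes to the limit. Stability itself is not a closed condition; it is recovered from
  the limiting equation by \<open>feasibleI\<close>.\<close>

lemma sublevel_compact:
  assumes \<alpha>: "\<alpha> \<longlonglongrightarrow> a" "\<And>k. 0 \<le> \<alpha> k" and K: "\<And>k. K k \<in> F (\<alpha> k)"
    and c: "\<And>k. J (K k) (\<alpha> k) \<le> c"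
  obtains r L where "strict_mono (r :: nat \<Rightarrow> nat)" "(\<lambda>k. K (r k)) \<longlonglongrightarrow> L" "L \<in> F a"
    "(\<lambda>k. J (K (r k)) (\<alpha> (r k))) \<longlonglongrightarrow> J L a"
proof -
  have "\<forall>k. \<exists>P. lyap (K k) (\<alpha> k) P \<and> J (K k) (\<alpha> k) = D0 \<bullet> P"
    using ex_lyap[OF K] by metis
  then obtain P where P: "\<And>k. lyap (K k) (\<alpha> k) (P k)" "\<And>k. J (K k) (\<alpha> k) = D0 \<bullet> P k"
    by metis
  obtain d where d: "d > 0" "\<And>(P :: real^'n^'n) z. pos_semidef P \<Longrightarrow> norm (P *v z) \<le> (D0 \<bullet> P) / d * norm z"
    using ex_trace_norm_bound by blast
  have Pb: "onorm ((*v) (P k)) \<le> c / d" for k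
  proof (rule onorm_le)
    fix z
    have "norm (P k *v z) \<le> (D0 \<bullet> P k) / d * norm z" using P(1) d(2) by (simp add: lyap_def)
    also have "\<dots> \<le> c / d * norm z"
      using c[of k] d(1) unfolding P(2) by (intro mult_right_mono divide_right_mono) auto
    finally show "norm (P k *v z) \<le> c / d * norm z" .
  qed
  obtain u where u: "\<And>k. \<bar>\<alpha> k\<bar> \<le> u"
    using convergent_imp_bounded[OF \<alpha>(1)] by (auto simp: bounded_iff)
  obtain b where b: "\<And>K \<alpha> P. lyap K \<alpha> P \<Longrightarrow> \<bar>\<alpha>\<bar> \<le> u \<Longrightarrow> onorm ((*v) P) \<le> c / d \<Longrightarrow> onorm ((*v) K) \<le> b"
    using lyap_gain_bound by blast
  have Kb: "norm (K k) \<le> real CARD('m) * real CARD('n) * b" for k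
    by (rule order_trans[OF norm_matrix_le_onorm]) (intro mult_left_mono b[OF P(1) u Pb], simp)
  have Pb': "norm (P k) \<le> real CARD('n) * real CARD('n) * (c / d)" for k
    by (rule order_trans[OF norm_matrix_le_onorm]) (intro mult_left_mono Pb, simp)
  have "bounded (range (\<lambda>k. (K k, P k)))"
  proof (rule boundedI)
    fix x assume "x \<in> range (\<lambda>k. (K k, P k))"
    then obtain k where "x = (K k, P k)" by blast
    then show "norm x \<le> real CARD('m) * real CARD('n) * b + real CARD('n) * real CARD('n) * (c / d)"
      unfolding \<open>x = (K k, P k)\<close> using norm_Pair_le[of "K k" "P k"] Kb[of k] Pb'[of k] by linarith
  qed
  from bounded_imp_convergent_subsequence[OF this] obtain L N and r :: "nat \<Rightarrow> nat"
    where r: "strict_mono r" and lim: "(\<lambda>k. (K (r k), P (r k))) \<longlonglongrightarrow> (L, N)"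
    by (auto simp: o_def)
  have limK: "(\<lambda>k. K (r k)) \<longlonglongrightarrow> L" using tendsto_fst[OF lim] by simp
  have limP: "(\<lambda>k. P (r k)) \<longlonglongrightarrow> N" using tendsto_snd[OF lim] by simp
  have lim\<alpha>: "(\<lambda>k. \<alpha> (r k)) \<longlonglongrightarrow> a"
    using LIMSEQ_subseq_LIMSEQ[OF \<alpha>(1) r] by (simp add: o_def)
  note limKx = tendsto_matrix_vector[OF limK] and limPx = tendsto_matrix_vector[OF limP]
  have limM: "(\<lambda>k. X *v Y k) \<longlonglongrightarrow> X *v y" if "Y \<longlonglongrightarrow> y" for X :: "real^'c^'d" and Y y
    by (rule bounded_linear.tendsto[OF _ that]) simp
  have "L \<in> S"
    using closed_sequentially[OF closed_subspace[OF S] _ limK] K by (simp add: feasible_gains_def)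
  have "(\<lambda>k. P (r k) $ i $ j - P (r k) $ j $ i) \<longlonglongrightarrow> N $ i $ j - N $ j $ i" for i j
    by (intro tendsto_diff tendsto_vec_nth limP)
  moreover have "P (r k) $ i $ j - P (r k) $ j $ i = 0" for i j k
    using P(1)[of "r k"] unfolding lyap_def pos_semidef_def by (simp add: transpose_def vec_eq_iff)
  ultimately have sym: "N $ i $ j = N $ j $ i" for i j by (simp add: LIMSEQ_const_iff)
  have "0 \<le> x \<bullet> (N *v x)" for x
  proof (rule LIMSEQ_le_const)
    show "(\<lambda>k. x \<bullet> (P (r k) *v x)) \<longlonglongrightarrow> x \<bullet> (N *v x)" by (intro tendsto_intros limPx)
    show "\<exists>M. \<forall>k\<ge>M. 0 \<le> x \<bullet> (P (r k) *v x)" using P(1) by (auto simp: lyap_def pos_semidef_def)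
  qed
  with sym have N: "pos_semidef N" unfolding pos_semidef_def by (simp add: transpose_def vec_eq_iff)
  have "2 * (cl L a x \<bullet> (N *v x)) = - rc L x" for x
  proof (rule LIMSEQ_unique)
    show "(\<lambda>k. 2 * (cl (K (r k)) (\<alpha> (r k)) x \<bullet> (P (r k) *v x))) \<longlonglongrightarrow> 2 * (cl L a x \<bullet> (N *v x))"
      unfolding cl_eq by (intro tendsto_intros limM limKx limPx lim\<alpha>)
    have "(\<lambda>k. - rc (K (r k)) x) \<longlonglongrightarrow> - rc L x"
      unfolding running_cost_def by (intro tendsto_intros limM limKx)
    then show "(\<lambda>k. 2 * (cl (K (r k)) (\<alpha> (r k)) x \<bullet> (P (r k) *v x))) \<longlonglongrightarrow> - rc L x"
      using P(1) by (simp add: lyap_def)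
  qed
  with N have lyap: "lyap L a N" by (simp add: lyap_def)
  have "0 \<le> a" using \<alpha> by (intro LIMSEQ_le_const) auto
  with lyap have L: "L \<in> F a" using \<open>L \<in> S\<close> by (intro feasibleI) (auto simp: lyap_def)
  have "(\<lambda>k. J (K (r k)) (\<alpha> (r k))) \<longlonglongrightarrow> J L a"
    unfolding P(2) lyap_cost[OF L lyap] by (intro tendsto_intros limP)
  with that r limK L show thesis by blast
qed

section \<open>Existence and dependence on the damping of optimal gains\<close>

abbreviation "opt \<equiv> optimal_gains M x0 A B Q R S"
abbreviation "opt_cost \<equiv> optimal_cost M x0 A B Q R S"

lemma opt_feasible: "K \<in> opt \<alpha> \<Longrightarrow> K \<in> F \<alpha>"
  and opt_le: "K \<in> opt \<alpha> \<Longrightarrow> K' \<in> F \<alpha> \<Longrightarrow> J K \<alpha> \<le> J K' \<alpha>"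
  by (auto simp: optimal_gains_def)

lemma opt_cost_eq:
  assumes "K \<in> opt \<alpha>"
  shows "opt_cost \<alpha> = J K \<alpha>"
proof -
  have "(\<lambda>K. J K \<alpha>) ` opt \<alpha> = {J K \<alpha>}"
    using assms by (auto simp: optimal_gains_def intro: antisym)
  then show ?thesis by (simp add: optimal_cost_def)
qed

text \<open>Direct method: a minimizing sequence at constant damping has a feasible limit point, and
  the cost converges along it.\<close>

lemma opt_nonempty:
  assumes K0: "K0 \<in> F a" and a: "0 \<le> a"
  shows "opt a \<noteq> {}"
proof -
  let ?X = "(\<lambda>K. J K a) ` F a"
  have bdd: "bdd_below ?X" by (rule bdd_belowI[of _ 0]) (auto intro: cost_nonneg)
  have ne: "?X \<noteq> {}" using K0 by auto
  have "\<exists>K\<in>F a. J K a < Inf ?X + 1 / real (Suc k)" for k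
    using cInf_lessD[OF ne, of "Inf ?X + 1 / real (Suc k)"] by auto
  then obtain K where K: "\<And>k. K k \<in> F a" "\<And>k. J (K k) a < Inf ?X + 1 / real (Suc k)" by metis
  have le: "J (K k) a \<le> Inf ?X + 1" for k
  proof -
    have "1 / real (Suc k) \<le> 1" by simp
    with K(2)[of k] show ?thesis by linarith
  qed
  obtain r L where L: "strict_mono (r :: nat \<Rightarrow> nat)" "(\<lambda>k. K (r k)) \<longlonglongrightarrow> L" "L \<in> F a"
    "(\<lambda>k. J (K (r k)) a) \<longlonglongrightarrow> J L a"
    by (rule sublevel_compact[OF tendsto_const a K(1) le])
  have "(\<lambda>k. Inf ?X + 1 / real (Suc (r k))) \<longlonglongrightarrow> Inf ?X + 0"
    using LIMSEQ_subseq_LIMSEQ[OF LIMSEQ_inverse_real_of_nat L(1)]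
    by (intro tendsto_add tendsto_const) (simp add: o_def inverse_eq_divide)
  then have "J L a \<le> Inf ?X + 0"
    by (rule LIMSEQ_le[OF L(4)]) (use K(2) less_imp_le in blast)
  moreover have "Inf ?X \<le> J K' a" if "K' \<in> F a" for K' using that bdd by (auto intro: cInf_lower)
  ultimately have "L \<in> opt a" using L(3) by (force simp: optimal_gains_def)
  then show ?thesis by blast
qed

text \<open>The common core of hemicontinuity and continuity. The fixed gain \<open>K0\<close> stays
  feasible under more damping at no higher cost, which puts all the optimal gains into one sublevel
  set.\<close>

lemma opt_sequence:
  assumes \<alpha>: "\<alpha> \<longlonglongrightarrow> a" "\<And>k. 0 \<le> \<alpha> k" and K: "\<And>k. K k \<in> opt (\<alpha> k)" and K0: "K0 \<in> F 0"
  obtains r L where "strict_mono (r :: nat \<Rightarrow> nat)" "(\<lambda>k. K (r k)) \<longlonglongrightarrow> L" "L \<in> opt a"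
    "(\<lambda>k. opt_cost (\<alpha> (r k))) \<longlonglongrightarrow> opt_cost a"
proof -
  have "J (K k) (\<alpha> k) \<le> J K0 0" for k
  proof -
    have "J (K k) (\<alpha> k) \<le> J K0 (\<alpha> k)" using opt_le[OF K feasible_mono[OF K0 \<alpha>(2)]] .
    also have "\<dots> \<le> J K0 0"
      using cost_strict_antimono[OF K0] \<alpha>(2)[of k] by (cases "\<alpha> k = 0") (auto simp: less_le)
    finally show ?thesis .
  qed
  with sublevel_compact[OF \<alpha> opt_feasible[OF K]] obtain r L where
    L: "strict_mono (r :: nat \<Rightarrow> nat)" "(\<lambda>k. K (r k)) \<longlonglongrightarrow> L" "L \<in> F a"
    "(\<lambda>k. J (K (r k)) (\<alpha> (r k))) \<longlonglongrightarrow> J L a" by blast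
  \<comment> \<open>A competitor at \<open>a\<close> also competes at nearby dampings, at a price of
    at most \<open>e\<close>; letting \<open>k\<close> grow and then \<open>e\<close> shrink shows
    that \<open>L\<close> is optimal.\<close>
  have "J L a \<le> J K' a" if K': "K' \<in> F a" for K'
  proof (rule field_le_epsilon)
    fix e :: real assume "e > 0"
    from cost_upper_semicontinuous[OF K' this] obtain \<delta> where
      \<delta>: "\<delta> > 0" "\<And>\<alpha>. 0 \<le> \<alpha> \<Longrightarrow> \<bar>\<alpha> - a\<bar> < \<delta> \<Longrightarrow> K' \<in> F \<alpha> \<and> J K' \<alpha> \<le> J K' a + e" by blast
    have "eventually (\<lambda>k. \<bar>\<alpha> (r k) - a\<bar> < \<delta>) sequentially"
      using tendstoD[OF LIMSEQ_subseq_LIMSEQ[OF \<alpha>(1) L(1)] \<delta>(1)] by (simp add: dist_real_def)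
    then have "eventually (\<lambda>k. J (K (r k)) (\<alpha> (r k)) \<le> J K' a + e) sequentially"
    proof eventually_elim
      case (elim k)
      from \<delta>(2)[OF \<alpha>(2) elim] opt_le[OF K] show ?case by (meson order_trans)
    qed
    then show "J L a \<le> J K' a + e" by (rule tendsto_upperbound[OF L(4)]) simp
  qed
  with L(3) have "L \<in> opt a" by (simp add: optimal_gains_def)
  moreover have "(\<lambda>k. opt_cost (\<alpha> (r k))) \<longlonglongrightarrow> opt_cost a"
    using L(4) by (simp add: opt_cost_eq[OF K] opt_cost_eq[OF \<open>L \<in> opt a\<close>])
  ultimately show thesis using that L by blast
qed

lemma opt_properties:
  assumes K0: "K0 \<in> opt 0"
  shows "\<forall>\<alpha>>0. opt \<alpha> \<noteq> {}" and "upper_hemicontinuous_on {0..} opt"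
    and "continuous_on {0..} opt_cost" and "strict_antimono_on {0..} opt_cost"
proof -
  note F0 = opt_feasible[OF K0]
  have ne: "opt \<alpha> \<noteq> {}" if "0 \<le> \<alpha>" for \<alpha>
    using opt_nonempty[OF feasible_mono[OF F0 that] that] .
  then show "\<forall>\<alpha>>0. opt \<alpha> \<noteq> {}" by simp
  show "upper_hemicontinuous_on {0..} opt"
    unfolding upper_hemicontinuous_on_def
  proof (intro ballI allI impI, elim conjE, rule ccontr)
    fix a :: real and V
    assume V: "open V" "opt a \<subseteq> V"
      and no: "\<nexists>U. open U \<and> a \<in> U \<and> \<Union> (opt ` (U \<inter> {0..})) \<subseteq> V"
    have "\<exists>x\<ge>0. \<bar>x - a\<bar> < \<delta> \<and> \<not> opt x \<subseteq> V" if "\<delta> > 0" for \<delta>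
    proof (rule ccontr)
      assume neg: "\<not> ?thesis"
      have "opt x \<subseteq> V" if "x \<in> ball a \<delta> \<inter> {0..}" for x
      proof -
        have "\<bar>x - a\<bar> < \<delta>" "0 \<le> x" using that by (auto simp: dist_real_def abs_minus_commute)
        with neg show ?thesis by metis
      qed
      then have "\<Union> (opt ` (ball a \<delta> \<inter> {0..})) \<subseteq> V" by (rule UN_least)
      moreover have "a \<in> ball a \<delta>" using \<open>\<delta> > 0\<close> by simp
      ultimately show False using no open_ball[of a \<delta>] by metis
    qed
    from sequence_into[of a "\<lambda>x. \<not> opt x \<subseteq> V", OF this] obtain \<alpha> where
      \<alpha>: "\<alpha> \<longlonglongrightarrow> a" "\<And>k::nat. 0 \<le> \<alpha> k" "\<And>k. \<not> opt (\<alpha> k) \<subseteq> V" by blast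
    from \<alpha>(3) have "\<forall>k. \<exists>K. K \<in> opt (\<alpha> k) \<and> K \<notin> V" by blast
    then obtain K where K: "\<And>k. K k \<in> opt (\<alpha> k)" "\<And>k. K k \<notin> V" by metis
    \<comment> \<open>Optimal gains outside \<open>V\<close> accumulate at an optimal gain for
      \<open>a\<close>, which lies in the open set \<open>V\<close>.\<close>
    obtain r L where L: "(\<lambda>k. K (r k)) \<longlonglongrightarrow> L" "L \<in> opt a"
      using opt_sequence[OF \<alpha>(1,2) K(1) F0] by blast
    have "eventually (\<lambda>k. K (r k) \<in> V) sequentially"
      using topological_tendstoD[OF L(1) V(1)] V(2) L(2) by blast
    with K(2) show False by simp
  qed
  show "continuous_on {0..} opt_cost"
    unfolding continuous_on_iff
  proof (intro ballI allI impI, rule ccontr)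
    fix a e :: real
    assume e: "e > 0"
      and no: "\<not> (\<exists>d>0. \<forall>x'\<in>{0..}. dist x' a < d \<longrightarrow> dist (opt_cost x') (opt_cost a) < e)"
    have "\<exists>x\<ge>0. \<bar>x - a\<bar> < \<delta> \<and> \<not> dist (opt_cost x) (opt_cost a) < e" if "\<delta> > 0" for \<delta>
      using no that by (auto simp: dist_real_def[of _ a])
    from sequence_into[of a "\<lambda>x. \<not> dist (opt_cost x) (opt_cost a) < e", OF this] obtain \<alpha> where
      \<alpha>: "\<alpha> \<longlonglongrightarrow> a" "\<And>k::nat. 0 \<le> \<alpha> k" "\<And>k. \<not> dist (opt_cost (\<alpha> k)) (opt_cost a) < e" by blast
    have "\<forall>k. \<exists>K. K \<in> opt (\<alpha> k)" using ne \<alpha>(2) by blast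
    then obtain K where K: "\<And>k. K k \<in> opt (\<alpha> k)" by metis
    \<comment> \<open>One convergent subsequence suffices, since every term keeps distance at least
      \<open>e\<close>.\<close>
    obtain r where "(\<lambda>k. opt_cost (\<alpha> (r k))) \<longlonglongrightarrow> opt_cost a"
      using opt_sequence[OF \<alpha>(1,2) K F0] by blast
    from tendstoD[OF this e] \<alpha>(3) show False by simp
  qed
  show "strict_antimono_on {0..} opt_cost"
  proof (rule monotone_onI)
    fix a b :: real assume ab: "a \<in> {0..}" "b \<in> {0..}" "a < b"
    obtain K K' where K: "K \<in> opt a" "K' \<in> opt b" using ne ab by fastforce
    \<comment> \<open>The optimal gain for \<open>a\<close> is a competitor at \<open>b\<close>, so
      strict decrease for this fixed gain passes to the minima.\<close>
    have "J K' b \<le> J K b"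
      using opt_le[OF K(2) feasible_mono[OF opt_feasible[OF K(1)]]] ab by simp
    also have "\<dots> < J K a" using cost_strict_antimono[OF opt_feasible[OF K(1)] ab(3)] .
    finally show "opt_cost b < opt_cost a" using K by (simp add: opt_cost_eq)
  qed
qed

end

theorem theorem1:
  fixes M :: "'w measure" and x0 :: "'w \<Rightarrow> real^'n"
    and A :: "real^'n^'n" and B :: "real^'m^'n"
    and Q D0 :: "real^'n^'n" and R :: "real^'m^'m"
    and S :: "(real^'n^'m) set"
  assumes "pos_semidef Q" and "pos_def R" and "pos_def D0"
    and "subspace S"
    and "prob_space M"
    and "has_bochner_integral M x0 0"
    and "has_bochner_integral M (\<lambda>\<omega>. \<chi> i j. x0 \<omega> $ i * x0 \<omega> $ j) D0"
    and "detectable A Q" and "Q \<noteq> 0"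
    and "optimal_gains M x0 A B Q R S 0 \<noteq> {}"
  shows "(\<forall>\<alpha>>0. optimal_gains M x0 A B Q R S \<alpha> \<noteq> {})
    \<and> upper_hemicontinuous_on {0..} (\<lambda>\<alpha>. optimal_gains M x0 A B Q R S \<alpha>)
    \<and> continuous_on {0..} (\<lambda>\<alpha>. optimal_cost M x0 A B Q R S \<alpha>)
    \<and> strict_antimono_on {0..} (\<lambda>\<alpha>. optimal_cost M x0 A B Q R S \<alpha>)"
proof -
  interpret prob_space M by fact
  interpret lqr M x0 A B Q D0 R S by unfold_locales fact+
  from assms obtain K0 where "K0 \<in> optimal_gains M x0 A B Q R S 0" by blast
  from opt_properties[OF this] show ?thesis by blast
qed

end
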